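(* Let $(a,F)$ be a game with associated measure $\rho$ on $(0,\infty)$. Suppose $E<\infty$ and $\lim_{m\to E^-}\frac{u_{\max}(m)}{E-m}$ exists and is nonzero. Then $\lim_{m\to E^-}u_{\max}'(m)$ exists (derivative with respect to $m$) and there is a number $r$ with $0\le r<1$ such that $$\lim_{m\to E^-}\frac{u_{\max}(m)}{E-m}=-\lim_{m\to E^-}u_{\max}'(m)=\frac{1-r}{2-r},$$ the function $x\mapsto\int_0^x\rho(dt)$ is regularly varying of index $r$, and for every $n>1$, $r$ is the upper order of the function $x\mapsto\int_0^\infty\left(\frac{x}{x+t}\right)^n\rho(dt)$.
   Context: A game is a pair $(a,F)$, where $F$ is a probability distribution function on an interval $I\subseteq\mathbb{R}$ (so $\int_I dF=1$) and $a:I\to\mathbb{R}$ is measurable and not constant $F$-almost everywhere. Put $E=\int_I a(x)\,dF$, $\xi=\operatorname{ess\,inf}_{x\in I}a(x)$ (with respect to $F$), and $H_\xi=\int_I \frac{1}{a(x)-\xi}\,dF\in(0,\infty]$, where $H_\xi=\infty$ if $\int_{a(x)=\xi}dF>0$, and $1/H_\xi=0$ if $H_\xi=\infty$. Standing assumptions: $E>0$ and $\xi>-\infty$. One has $\xi+1/H_\xi<E$. Define $\Psi(c)=1/\int_I (a(x)+c)^{-1}dF-c$ for $c>-\xi$. For $m\in(\xi+1/H_\xi,E)$ and $0<u<E-m$, the optimal proportion of investment at price $u$ for the translated game $(a-m,F)$ is the unique $t=t_u^{(m)}\in(0,u/(u+m-\xi))$ with $\int_I \frac{a(x)-m-u}{(a(x)-m)t-tu+u}\,dF=0$.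 Then $u_{\max}(m)$ denotes the unique number in $(0,E-m)$ such that $u\mapsto t_u^{(m)}$ is strictly increasing on $(0,u_{\max}(m))$ and strictly decreasing on $(u_{\max}(m),E-m)$. The measure $\rho$ associated with the game is the unique measure on $(0,\infty)$ with $\int_0^\infty\frac{1}{t(t+1)}\rho(dt)<\infty$ and $\Psi(c)=\xi+\frac1{H_\xi}+\int_0^\infty\frac{c+\xi}{t(t+c+\xi)}\rho(dt)$ for all $c>-\xi$. A measurable function $f$, positive for all large $x$, is regularly varying of index $r\in\mathbb{R}$ (written $f\in R_r$) if $\lim_{x\to\infty}f(\lambda x)/f(x)=\lambda^r$ for every $\lambda>0$. The upper order of a positive function $f$ is $\omega_f=\limsup_{x\to\infty}\log f(x)/\log x$. *)

theory Defs
  imports "HOL-Probability.Probability"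
begin

(* F is extended to the whole real line as an ordinary cumulative distribution function
   all of whose mass lies on I; the integral over I with respect to dF is integration
   against its Lebesgue-Stieltjes measure restricted to I. *)

definition prob_distribution_on :: "real set \<Rightarrow> (real \<Rightarrow> real) \<Rightarrow> bool" where
  "prob_distribution_on I F \<longleftrightarrow>
     mono F \<and> (\<forall>x. continuous (at_right x) F) \<and>
     (F \<longlongrightarrow> 0) at_bot \<and> (F \<longlongrightarrow> 1) at_top \<and>
     emeasure (interval_measure F) I = 1"

definition game_measure :: "real set \<Rightarrow> (real \<Rightarrow> real) \<Rightarrow> real measure" where
  "game_measure I F = restrict_space (interval_measure F) I"

definition expected_value :: "real set \<Rightarrow> (real \<Rightarrow> real) \<Rightarrow> (real \<Rightarrow> real) \<Rightarrow> ereal" where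
  "expected_value I a F =
     enn2ereal (\<integral>\<^sup>+x. ennreal (a x) \<partial>game_measure I F)
     - enn2ereal (\<integral>\<^sup>+x. ennreal (- a x) \<partial>game_measure I F)"

definition ess_inf :: "'a measure \<Rightarrow> ('a \<Rightarrow> real) \<Rightarrow> ereal" where
  "ess_inf M f = - esssup M (\<lambda>x. - ereal (f x))"

definition game_xi :: "real set \<Rightarrow> (real \<Rightarrow> real) \<Rightarrow> (real \<Rightarrow> real) \<Rightarrow> real" where
  "game_xi I a F = real_of_ereal (ess_inf (game_measure I F) a)"

definition game :: "real set \<Rightarrow> (real \<Rightarrow> real) \<Rightarrow> (real \<Rightarrow> real) \<Rightarrow> bool" where
  "game I a F \<longleftrightarrow>
     is_interval I \<and> prob_distribution_on I F \<and>
     a \<in> borel_measurable (restrict_space borel I) \<and>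
     \<not> (\<exists>k. AE x in game_measure I F. a x = k) \<and>
     expected_value I a F > 0 \<and>
     ess_inf (game_measure I F) a > - \<infinity>"

(* In ennreal, 1 / 0 = top and 1 / top = 0. Hence the value is top as soon as a = xi with
   positive probability, and 1 / game_H is 0 whenever game_H is top. *)
definition game_H :: "real set \<Rightarrow> (real \<Rightarrow> real) \<Rightarrow> (real \<Rightarrow> real) \<Rightarrow> ennreal" where
  "game_H I a F = (\<integral>\<^sup>+x. 1 / ennreal (a x - game_xi I a F) \<partial>game_measure I F)"

definition game_Psi :: "real set \<Rightarrow> (real \<Rightarrow> real) \<Rightarrow> (real \<Rightarrow> real) \<Rightarrow> real \<Rightarrow> real" where
  "game_Psi I a F c = 1 / (\<integral>x. inverse (a x + c) \<partial>game_measure I F) - c"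

(* Only meaningful for xi + 1/H < m < E and 0 < u < E - m. *)
definition opt_proportion ::
    "real set \<Rightarrow> (real \<Rightarrow> real) \<Rightarrow> (real \<Rightarrow> real) \<Rightarrow> real \<Rightarrow> real \<Rightarrow> real" where
  "opt_proportion I a F m u =
     (THE t. 0 < t \<and> t < u / (u + m - game_xi I a F) \<and>
        (\<integral>x. (a x - m - u) / ((a x - m) * t - t * u + u) \<partial>game_measure I F) = 0)"

(* Only meaningful for xi + 1/H < m < E. *)
definition u_max :: "real set \<Rightarrow> (real \<Rightarrow> real) \<Rightarrow> (real \<Rightarrow> real) \<Rightarrow> real \<Rightarrow> real" where
  "u_max I a F m =
     (THE v. 0 < v \<and> ereal v < expected_value I a F - ereal m \<and>
        strict_mono_on {0<..<v} (opt_proportion I a F m) \<and>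
        strict_antimono_on {u. v < u \<and> ereal u < expected_value I a F - ereal m}
          (opt_proportion I a F m))"

definition associated_measure ::
    "real set \<Rightarrow> (real \<Rightarrow> real) \<Rightarrow> (real \<Rightarrow> real) \<Rightarrow> real measure \<Rightarrow> bool" where
  "associated_measure I a F \<rho> \<longleftrightarrow>
     sets \<rho> = sets (restrict_space borel {0<..}) \<and>
     (\<integral>\<^sup>+t. ennreal (1 / (t * (t + 1))) \<partial>\<rho>) < \<infinity> \<and>
     (\<forall>c > - game_xi I a F.
        game_Psi I a F c = game_xi I a F + enn2real (1 / game_H I a F)
          + (\<integral>t. (c + game_xi I a F) / (t * (t + c + game_xi I a F)) \<partial>\<rho>))"

definition regularly_varying :: "real \<Rightarrow> (real \<Rightarrow> real) \<Rightarrow> bool" where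
  "regularly_varying r f \<longleftrightarrow>
     f \<in> borel_measurable borel \<and> (\<forall>\<^sub>F x in at_top. f x > 0) \<and>
     (\<forall>l>0. ((\<lambda>x. f (l * x) / f x) \<longlongrightarrow> l powr r) at_top)"

(* The upper order is a notion for positive functions on the positive half-line; positivity
   is part of the predicate, as ln takes junk values on nonpositive arguments. *)
definition has_upper_order :: "(real \<Rightarrow> real) \<Rightarrow> ereal \<Rightarrow> bool" where
  "has_upper_order f \<omega> \<longleftrightarrow>
     (\<forall>x>0. f x > 0) \<and> Limsup at_top (\<lambda>x. ereal (ln (f x) / ln x)) = \<omega>"

end

theory Submission
  imports Defs "HOL-Real_Asymp.Real_Asymp"
begin

text \<open>Put \<open>s = c + \<xi>\<close>, \<open>\<mu> = E - \<xi>\<close> and let \<open>S n s\<close> be the integral of \<open>(t + s)\<^sup>-\<^sup>n\<close> against \<open>\<rho>\<close>, so that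
  \<open>\<Psi> c = E - S 1 s\<close>. The first-order condition for the optimal proportion at price \<open>u\<close> reads
  \<open>\<Psi> c = m + u\<close>, and maximising over \<open>u\<close> expresses \<open>m\<close> as an increasing function of \<open>s\<close> with
  \<open>u_max m = S 2 s * (s + m - \<xi>)\<close>. As \<open>m\<close> tends to \<open>E\<close>, \<open>s\<close> tends to infinity, and the hypothesis becomes
  \<open>s * S 2 s / S 1 s \<longlongrightarrow> 1 - r\<close>. Since \<open>S 1\<close> has derivative \<open>- S 2\<close>, it is regularly varying of index
  \<open>r - 1\<close>. The monotone density theorem passes this on to every \<open>S n\<close>, which gives the limit of the
  derivative of \<open>u_max\<close>, and a Karamata argument (moments and Weierstrass approximation in the variable
  \<open>x / (x + t)\<close>) transfers it to the distribution function of \<open>\<rho>\<close>.\<close>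

section \<open>Asymptotics of real functions\<close>

text \<open>\<open>u_max\<close> is given only through two nested descriptions, so neither a formula
  in \<open>m\<close> nor differentiability is at hand; the parameter \<open>s\<close> supplies
  both. Stationarity gives \<open>E - m = u_max m + S 1 s\<close>, so the given quotient is
  \<open>k / (k + 1)\<close> with \<open>k = S 2 s * (s + m - \<xi>) / S 1 s\<close>, and
  \<open>k\<close> behaves like \<open>s * S 2 s / S 1 s\<close> because \<open>m\<close> stays
  bounded. The inequality \<open>s * S 2 s \<le> S 1 s\<close> puts the limit of \<open>k\<close>
  into [0, 1], and a nonzero limit of the quotient removes 0: this is where
  \<open>0 \<le> r < 1\<close> comes from. The strict inequality drives the Tauberian half: it says
  that \<open>x * x * S 2 x\<close> keeps a positive share of \<open>x * S 1 x\<close>, so the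
  distribution function of \<rho> cannot be of smaller order than \<open>x * S 1 x\<close>. That
  half asks only for existence and positivity of a limit, so the limit law of
  \<open>x / (x + t)\<close> is never computed.\<close>

lemma tendsto_if_approximable:
  fixes h :: "'a \<Rightarrow> real"
  assumes "F \<noteq> bot"
    and approx: "\<And>e. e > 0 \<Longrightarrow> \<exists>g l. (g \<longlongrightarrow> l) F \<and> (\<forall>\<^sub>F x in F. \<bar>h x - g x\<bar> \<le> e)"
  obtains l where "(h \<longlongrightarrow> l) F"
proof -
  \<comment> \<open>The limits of the approximants depend on the tolerance and are not known to
    converge, so the limit of \<open>h\<close> cannot be named. Each approximant only traps
    \<open>h\<close> in a small ball, which is the Cauchy property; completeness of the reals does
    the rest.\<close>
  have "cauchy_filter (filtermap h F)"
    unfolding cauchy_filter_metric_filtermap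
  proof (intro allI impI)
    fix e :: real assume "e > 0"
    then obtain g l where g: "(g \<longlongrightarrow> l) F" and ev: "\<forall>\<^sub>F x in F. \<bar>h x - g x\<bar> \<le> e / 8"
      using approx[of "e / 8"] by auto
    have "\<forall>\<^sub>F x in F. dist (g x) l < e / 8"
      using tendstoD[OF g, of "e / 8"] \<open>e > 0\<close> by simp
    with ev have "\<forall>\<^sub>F x in F. dist (h x) l < e / 4"
      unfolding dist_real_def by eventually_elim linarith
    moreover have "dist (h x) (h y) < e" if "dist (h x) l < e / 4" "dist (h y) l < e / 4" for x y
      using that \<open>e > 0\<close> unfolding dist_real_def by linarith
    ultimately show "\<exists>P. eventually P F \<and> (\<forall>x y. P x \<and> P y \<longrightarrow> dist (h x) (h y) < e)"
      by (intro exI[of _ "\<lambda>x. dist (h x) l < e / 4"]) auto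
  qed
  moreover have "filtermap h F \<noteq> bot"
    using assms(1) by (simp add: filtermap_bot_iff)
  ultimately obtain l where "filtermap h F \<le> nhds l"
    using complete_UNIV[where 'a = real] unfolding complete_uniform by auto
  then show ?thesis using that by (simp add: filterlim_def)
qed

text \<open>In the coordinate \<open>z = ln x\<close> the hypothesis says that
  \<open>ln (f (exp z))\<close> has a derivative tending to \<sigma>, so its increments over the
  fixed length \<open>ln l\<close> tend to \<open>\<sigma> * ln l\<close>.\<close>

lemma ratio_tendsto_if_log_derivative:
  fixes f f' :: "real \<Rightarrow> real"
  assumes pos: "\<And>x. x > 0 \<Longrightarrow> f x > 0"
    and deriv: "\<And>x. x > 0 \<Longrightarrow> (f has_real_derivative f' x) (at x)"
    and lim: "((\<lambda>x. x * f' x / f x) \<longlongrightarrow> \<sigma>) at_top"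
    and "l > 0"
  shows "((\<lambda>x. f (l * x) / f x) \<longlongrightarrow> l powr \<sigma>) at_top"
proof -
  define G where "G z = ln (f (exp z))" for z
  define k where "k = ln l"
  have dG: "(G has_real_derivative exp z * f' (exp z) / f (exp z)) (at z)" for z
    unfolding G_def
    by (rule derivative_eq_intros DERIV_chain2[OF deriv] refl | simp add: pos)+
  have limG: "((\<lambda>z. exp z * f' (exp z) / f (exp z)) \<longlongrightarrow> \<sigma>) at_top"
    using filterlim_compose[OF lim exp_at_top] .
  have incr: "((\<lambda>z. G (z + k) - G z) \<longlongrightarrow> \<sigma> * k) at_top"
  proof (rule tendstoI)
    fix e :: real assume "e > 0"
    define d where "d = e / (\<bar>k\<bar> + 1)"
    have "d > 0" using \<open>e > 0\<close> by (simp add: d_def)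
    then obtain N where N: "\<And>z. z \<ge> N \<Longrightarrow> dist (exp z * f' (exp z) / f (exp z)) \<sigma> < d"
      using tendstoD[OF limG] unfolding eventually_at_top_linorder by meson
    show "\<forall>\<^sub>F z in at_top. dist (G (z + k) - G z) (\<sigma> * k) < e"
      \<comment> \<open>The shift by \<open>\<bar>k\<bar>\<close> puts both \<open>z\<close> and
        \<open>z + k\<close> beyond \<open>N\<close>, since \<open>k\<close> is negative when
        \<open>l < 1\<close>.\<close>
      using eventually_ge_at_top[of "N + \<bar>k\<bar>"]
    proof eventually_elim
      case (elim z)
      have "norm ((G (z + k) - \<sigma> * (z + k)) - (G z - \<sigma> * z)) \<le> d * norm ((z + k) - z)"
      proof (rule field_differentiable_bound[of "{N..}"])
        fix y assume "y \<in> {N..}"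
        show "((\<lambda>z. G z - \<sigma> * z) has_field_derivative exp y * f' (exp y) / f (exp y) - \<sigma>)
                (at y within {N..})"
          by (rule derivative_eq_intros DERIV_subset[OF dG] refl | simp)+
        show "norm (exp y * f' (exp y) / f (exp y) - \<sigma>) \<le> d"
          using N[of y] \<open>y \<in> {N..}\<close> by (simp add: dist_real_def)
      qed (use elim in auto)
      also have "\<dots> < e"
        using \<open>e > 0\<close> by (simp add: d_def field_simps)
      finally show ?case by (simp add: dist_real_def algebra_simps)
    qed
  qed
  have "((\<lambda>x. exp (G (ln x + k) - G (ln x))) \<longlongrightarrow> exp (\<sigma> * k)) at_top"
    by (intro tendsto_exp filterlim_compose[OF incr ln_at_top])
  moreover have "\<forall>\<^sub>F x in at_top. exp (G (ln x + k) - G (ln x)) = f (l * x) / f x"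
    using eventually_gt_at_top[of 0]
  proof eventually_elim
    case (elim x)
    have "exp (ln x + k) = l * x" using elim \<open>l > 0\<close> by (simp add: exp_add k_def)
    then show ?case
      using elim pos[of x] pos[of "l * x"] \<open>l > 0\<close> by (simp add: G_def exp_diff)
  qed
  ultimately show ?thesis
    using \<open>l > 0\<close> by (simp add: tendsto_cong powr_def k_def)
qed

text \<open>By the mean value theorem \<open>(f x - f (l * x)) / (l - 1)\<close> equals
  \<open>x * g z\<close> for some \<open>z\<close> between \<open>x\<close> and
  \<open>l * x\<close>. As \<open>g\<close> is antitone, this bounds \<open>x * g x\<close> from
  below when \<open>l > 1\<close> and from above when \<open>l < 1\<close>. After division by
  \<open>f x\<close> the bounds tend to \<open>q l\<close>, and \<open>q l\<close> tends to \<sigma>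
  as \<open>l\<close> tends to 1, being minus a difference quotient of
  \<open>l powr (- \<sigma>)\<close>.\<close>

lemma monotone_density:
  fixes f g :: "real \<Rightarrow> real"
  assumes pos: "\<And>x. x > 0 \<Longrightarrow> f x > 0"
    and deriv: "\<And>x. x > 0 \<Longrightarrow> (f has_real_derivative - g x) (at x)"
    and anti: "\<And>x y. 0 < x \<Longrightarrow> x \<le> y \<Longrightarrow> g y \<le> g x"
    and ratio: "\<And>l. l > 0 \<Longrightarrow> ((\<lambda>x. f (l * x) / f x) \<longlongrightarrow> l powr (- \<sigma>)) at_top"
  shows "((\<lambda>x. x * g x / f x) \<longlongrightarrow> \<sigma>) at_top"
proof -
  define q where "q l = (1 - l powr (- \<sigma>)) / (l - 1)" for l :: real
  have "((\<lambda>l. l powr (- \<sigma>)) has_real_derivative - \<sigma>) (at 1)"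
    by (rule derivative_eq_intros refl | simp)+
  then have "((\<lambda>l. - ((l powr (- \<sigma>) - 1 powr (- \<sigma>)) / (l - 1))) \<longlongrightarrow> - (- \<sigma>)) (at 1)"
    unfolding has_field_derivative_iff by (rule tendsto_minus)
  then have q: "(q \<longlongrightarrow> \<sigma>) (at 1)"
    by (simp add: q_def[abs_def] minus_divide_left)
  have limq: "((\<lambda>x. (1 - f (l * x) / f x) / (l - 1)) \<longlongrightarrow> q l) at_top" if "l > 0" "l \<noteq> 1" for l
    unfolding q_def using that by (intro tendsto_intros ratio) auto
  show ?thesis
  proof (rule order_tendstoI)
    fix c assume "c < \<sigma>"
    have "\<forall>\<^sub>F l in at_right 1. q l > c \<and> l > 1"
      using order_tendstoD(1)[OF tendsto_mono[OF at_le q, of "{1<..}"] \<open>c < \<sigma>\<close>]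
      by (auto simp: eventually_conj_iff eventually_at_right_less)
    then obtain l where l: "q l > c" "l > 1"
      using eventually_happens'[OF trivial_limit_at_right_real] by blast
    have "\<forall>\<^sub>F x in at_top. (1 - f (l * x) / f x) / (l - 1) > c"
      using order_tendstoD(1)[OF limq] l by simp
    then show "\<forall>\<^sub>F x in at_top. c < x * g x / f x"
      using eventually_gt_at_top[of 0]
    proof eventually_elim
      case (elim x)
      obtain z where z: "x < z" "z < l * x" "f (l * x) - f x = (l * x - x) * (- g z)"
        using MVT2[of x "l * x" f "\<lambda>x. - g x"] deriv elim l by (auto simp: less_le_trans)
      have "(f x - f (l * x)) / (l - 1) = x * g z"
        using z(3) l by (simp add: field_simps)
      also have "\<dots> \<le> x * g x"
        using anti[of x z] z elim by simp
      finally have "(f x - f (l * x)) / (l - 1) / f x \<le> x * g x / f x"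
        using pos[of x] elim by (intro divide_right_mono) auto
      moreover have "(1 - f (l * x) / f x) / (l - 1) = (f x - f (l * x)) / (l - 1) / f x"
        using pos[of x] elim l by (simp add: field_simps)
      ultimately show ?case using elim by linarith
    qed
  next
    fix c assume "c > \<sigma>"
    have "\<forall>\<^sub>F l in at_left 1. q l < c \<and> 0 < l \<and> l < 1"
      using order_tendstoD(2)[OF tendsto_mono[OF at_le q, of "{..<1}"] \<open>c > \<sigma>\<close>]
        eventually_at_left_real[of 0 "1::real"] by (auto simp: eventually_conj_iff)
    then obtain l where l: "q l < c" "0 < l" "l < 1"
      using eventually_happens'[OF trivial_limit_at_left_real] by blast
    have "\<forall>\<^sub>F x in at_top. (1 - f (l * x) / f x) / (l - 1) < c"
      using order_tendstoD(2)[OF limq] l by simp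
    then show "\<forall>\<^sub>F x in at_top. x * g x / f x < c"
      using eventually_gt_at_top[of 0]
    proof eventually_elim
      case (elim x)
      have "0 < l * x" using elim l by simp
      then obtain z where z: "l * x < z" "z < x" "f x - f (l * x) = (x - l * x) * (- g z)"
        using MVT2[of "l * x" x f "\<lambda>x. - g x"] deriv elim l
          less_le_trans[OF \<open>0 < l * x\<close>] by auto
      have "x * g x \<le> x * g z"
        using anti[of z x] z elim \<open>0 < l * x\<close> by simp
      also have "\<dots> = (f x - f (l * x)) / (l - 1)"
        using z(3) l by (simp add: field_simps)
      finally have "x * g x / f x \<le> (f x - f (l * x)) / (l - 1) / f x"
        using pos[of x] elim by (intro divide_right_mono) auto
      moreover have "(1 - f (l * x) / f x) / (l - 1) = (f x - f (l * x)) / (l - 1) / f x"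
        using pos[of x] elim l by (simp add: field_simps)
      ultimately show ?case using elim by linarith
    qed
  qed
qed

text \<open>An equality of filters lets limits travel both ways: the hypothesis on \<open>m\<close>
  is moved to the parameter, and the conclusions are moved back. The second direction needs every
  point just below \<open>e\<close> to be a value of \<open>G\<close>, which is the intermediate
  value theorem.\<close>

lemma filtermap_at_top_eq_at_left:
  fixes G :: "real \<Rightarrow> real"
  assumes mono: "\<And>x y. 0 < x \<Longrightarrow> x < y \<Longrightarrow> G x < G y"
    and cont: "continuous_on {0<..} G"
    and lim: "(G \<longlongrightarrow> e) at_top"
  shows "filtermap G at_top = at_left e"
proof (rule antisym)
  have less: "G x < e" if "x > 0" for x
  proof -
    have "\<forall>\<^sub>F y in at_top. G (x + 1) \<le> G y"
      using eventually_gt_at_top[of "x + 1"]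
      by eventually_elim (use mono[of "x + 1"] that in \<open>auto intro: less_imp_le\<close>)
    then have "G (x + 1) \<le> e"
      by (rule tendsto_lowerbound[OF lim _ trivial_limit_at_top_linorder])
    then show ?thesis using mono[of x "x + 1"] that by linarith
  qed
  have "\<forall>\<^sub>F x in at_top. G x \<in> {..<e} \<and> G x \<noteq> e"
    using eventually_gt_at_top[of 0] by eventually_elim (use less in auto)
  with lim have "filterlim G (at_left e) at_top"
    by (simp add: filterlim_at)
  then show "filtermap G at_top \<le> at_left e"
    by (simp add: filterlim_def)
  show "at_left e \<le> filtermap G at_top"
  proof (rule filter_leI)
    fix P assume "eventually P (filtermap G at_top)"
    then obtain N0 where N0: "\<And>s. s \<ge> N0 \<Longrightarrow> P (G s)"
      by (auto simp: eventually_filtermap eventually_at_top_linorder)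
    define N where "N = max N0 1"
    have "P m" if m: "G N < m" "m < e" for m
    proof -
      have "\<forall>\<^sub>F s in at_top. G s > m \<and> s > N"
        using order_tendstoD(1)[OF lim m(2)] eventually_gt_at_top[of N] by (rule eventually_conj)
      then obtain s where s: "G s > m" "s > N"
        using eventually_happens'[OF trivial_limit_at_top_linorder] by blast
      have "continuous_on {N..s} G"
        by (rule continuous_on_subset[OF cont]) (auto simp: N_def)
      then obtain z where "N \<le> z" "G z = m"
        using IVT'[of G N m s] s m by auto
      then show ?thesis using N0[of z] by (simp add: N_def)
    qed
    moreover have "\<forall>\<^sub>F m in at_left e. m \<in> {G N<..<e}"
      using less[of N] by (intro eventually_at_left_real) (simp add: N_def)
    ultimately show "eventually P (at_left e)"
      by (auto elim!: eventually_mono)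
  qed
qed

text \<open>\<open>W\<close> is known only along the curve \<open>f\<close>. The values of
  \<open>f\<close> fill a neighbourhood of \<open>f x\<close>, where \<open>W\<close> therefore
  agrees with \<open>k\<close> composed with the inverse of \<open>f\<close>; this yields
  differentiability of \<open>W\<close> as well as the quotient.\<close>

lemma DERIV_along_parametrization:
  fixes f f' k W :: "real \<Rightarrow> real"
  assumes "c < x"
    and df: "\<And>y. y > c \<Longrightarrow> (f has_real_derivative f' y) (at y)"
    and pos: "\<And>y. y > c \<Longrightarrow> f' y > 0"
    and dk: "(k has_real_derivative D) (at x)"
    and W: "\<And>y. y > c \<Longrightarrow> W (f y) = k y"
  shows "(W has_real_derivative D / f' x) (at (f x))"
proof -
  have mono: "f y < f z" if "c < y" "y < z" for y z
  proof (rule DERIV_pos_imp_increasing[OF that(2)])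
    fix t assume "y \<le> t"
    then have "t > c" using that by simp
    then show "\<exists>d. (f has_real_derivative d) (at t) \<and> d > 0" using df pos by blast
  qed
  have "inj_on f {c<..}"
    by (intro inj_onI) (metis greaterThan_iff less_irrefl linorder_neqE mono)
  define g where "g = inv_into {c<..} f"
  have gf: "g (f y) = y" if "y > c" for y
    using \<open>inj_on f {c<..}\<close> that by (simp add: g_def)
  \<comment> \<open>The open interval from \<open>f p\<close> to \<open>f (x + 1)\<close> is the
    neighbourhood of \<open>f x\<close> on which \<open>f\<close> is inverted; the midpoint keeps
    \<open>p\<close> inside \<open>{c<..}\<close>.\<close>
  define p where "p = (c + x) / 2"
  have p: "c < p" "p < x" using \<open>c < x\<close> by (auto simp: p_def)
  have preimage: "\<exists>y>c. m = f y" if m: "f p < m" "m < f (x + 1)" for m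
  proof -
    have "isCont f y" if "p \<le> y" for y
      using DERIV_isCont[OF df, of y] p that by simp
    then obtain y where "p \<le> y" "f y = m"
      using IVT[of f p m "x + 1"] m p by auto
    then show ?thesis using p by (intro exI[of _ y]) auto
  qed
  have fx: "f p < f x" "f x < f (x + 1)" using mono[of p x] mono[of x "x + 1"] p by auto
  have "isCont g (f x)"
  proof (rule isCont_inverse_function[where d = "(x - c) / 2" and x = x and f = f and g = g])
    fix z assume "\<bar>z - x\<bar> \<le> (x - c) / 2"
    then have "- (z - x) \<le> (x - c) / 2" by (rule abs_le_D2)
    then have "z > c" using \<open>c < x\<close> by (simp add: field_simps)
    then show "g (f z) = z" "isCont f z" using gf DERIV_isCont[OF df] by auto
  qed (use \<open>c < x\<close> in simp)
  moreover have "f (g m) = m" if "f p < m" "m < f (x + 1)" for m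
    using preimage[OF that] gf by force
  ultimately have "(g has_real_derivative inverse (f' x)) (at (f x))"
    using df[OF \<open>c < x\<close>] pos[OF \<open>c < x\<close>] fx gf[OF \<open>c < x\<close>]
    by (intro DERIV_inverse_function[where f = f and a = "f p" and b = "f (x + 1)"]) auto
  then have "((\<lambda>m. k (g m)) has_real_derivative D * inverse (f' x)) (at (f x))"
    using dk gf[OF \<open>c < x\<close>] by (intro DERIV_chain2) auto
  then have "(W has_real_derivative D * inverse (f' x)) (at (f x))"
  proof (rule has_field_derivative_transform_within_open)
    show "k (g m) = W m" if "m \<in> {f p<..<f (x + 1)}" for m
      using preimage[of m] that gf W by force
  qed (use fx in auto)
  then show ?thesis by (simp add: divide_inverse)
qed

section \<open>Stieltjes transforms\<close>

locale half_line_measure =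
  fixes \<rho> :: "real measure"
  assumes sets_rho: "sets \<rho> = sets (restrict_space borel {0<..})"
begin

lemma space_rho: "space \<rho> = {0<..}"
  using sets_eq_imp_space_eq[OF sets_rho] by (simp add: space_restrict_space)

lemma measurable_rho: "f \<in> borel_measurable borel \<Longrightarrow> f \<in> borel_measurable \<rho>"
  for f :: "real \<Rightarrow> real"
  using measurable_restrict_space1 by (simp add: measurable_cong_sets[OF sets_rho refl])

end

text \<open>The measure of a game is only required to integrate \<open>1 / (t * (t + 1))\<close>.
  Integrability of \<open>1 / t\<close> is what a finite mean adds, and it makes
  \<open>1 / t\<close> the common majorant for all integrals below. Nonnullity gives strict
  positivity.\<close>

locale stieltjes_measure = half_line_measure +
  assumes integrable_inverse: "integrable \<rho> (\<lambda>t. 1 / t)"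
    and nonnull: "emeasure \<rho> (space \<rho>) \<noteq> 0"
begin

definition S :: "nat \<Rightarrow> real \<Rightarrow> real" where
  "S n s = (\<integral>t. 1 / (t + s) ^ n \<partial>\<rho>)"

lemma integrable_if_bounded_by_inverse:
  fixes f :: "real \<Rightarrow> real"
  assumes "f \<in> borel_measurable borel" and "\<And>t. t > 0 \<Longrightarrow> \<bar>f t\<bar> \<le> C / t"
  shows "integrable \<rho> f"
proof (rule Bochner_Integration.integrable_bound)
  show "integrable \<rho> (\<lambda>t. C * (1 / t))"
    by (intro integrable_mult_right integrable_inverse)
  show "AE t in \<rho>. norm (f t) \<le> norm (C * (1 / t))"
  proof (rule AE_I2)
    fix t assume "t \<in> space \<rho>"
    then show "norm (f t) \<le> norm (C * (1 / t))"
      using assms(2)[of t] abs_ge_self[of "C / t"] unfolding space_rho by auto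
  qed
qed (rule measurable_rho[OF assms(1)])

lemma integral_pos:
  fixes f :: "real \<Rightarrow> real"
  assumes "integrable \<rho> f" and "\<And>t. t > 0 \<Longrightarrow> f t > 0"
  shows "(\<integral>t. f t \<partial>\<rho>) > 0"
proof -
  have nonneg: "AE t in \<rho>. 0 \<le> f t"
    using assms(2) by (intro AE_I2) (simp add: space_rho less_imp_le)
  have "(\<integral>t. f t \<partial>\<rho>) \<noteq> 0"
  proof
    assume "(\<integral>t. f t \<partial>\<rho>) = 0"
    then have "AE t in \<rho>. f t = 0"
      using integral_nonneg_eq_0_iff_AE[OF assms(1) nonneg] by simp
    then have "AE t in \<rho>. False"
      using AE_space by eventually_elim (use assms(2) space_rho in force)
    then show False
      using nonnull by (simp add: AE_iff_measurable[of "space \<rho>"])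
  qed
  then show ?thesis
    using integral_nonneg_AE[OF nonneg] by simp
qed

text \<open>One of the \<open>n\<close> factors is bounded below by \<open>t\<close>, to reach the
  majorant \<open>1 / t\<close>, and the other \<open>n - 1\<close> by \<open>s\<close>.\<close>

lemma kernel_bound:
  assumes "n > 0" "s > 0" "t > (0::real)"
  shows "1 / (t + s) ^ n \<le> (1 / s ^ (n - 1)) / t"
proof -
  have "s ^ (n - 1) * t \<le> (t + s) ^ (n - 1) * (t + s)"
    using assms by (intro mult_mono power_mono) auto
  also have "\<dots> = (t + s) ^ n"
    using assms(1) by (rule power_minus_mult)
  finally show ?thesis
    using assms by (simp add: frac_le)
qed

lemma integrable_S:
  assumes "n > 0" "s > 0"
  shows "integrable \<rho> (\<lambda>t. 1 / (t + s) ^ n)"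
  using kernel_bound[OF assms] assms
  by (intro integrable_if_bounded_by_inverse[where C = "1 / s ^ (n - 1)"]) auto

lemma S_pos: "n > 0 \<Longrightarrow> s > 0 \<Longrightarrow> S n s > 0"
  unfolding S_def by (intro integral_pos integrable_S) auto

lemma S_antimono: "n > 0 \<Longrightarrow> 0 < s \<Longrightarrow> s \<le> s' \<Longrightarrow> S n s' \<le> S n s"
  unfolding S_def
  by (intro integral_mono integrable_S) (auto simp: space_rho intro!: frac_le power_mono)

text \<open>The extra factor \<open>s / (t + s)\<close> is at most 1. For \<open>n = 1\<close> this
  is what later confines the limit of \<open>s * S 2 s / S 1 s\<close> to values at most 1.\<close>

lemma S_Suc_le:
  assumes "n > 0" "s > 0"
  shows "s * S (Suc n) s \<le> S n s"
proof -
  have "s * S (Suc n) s = (\<integral>t. s * (1 / (t + s) ^ Suc n) \<partial>\<rho>)"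
    unfolding S_def by (rule integral_mult_right_zero[symmetric])
  also have "\<dots> \<le> S n s"
    unfolding S_def
  proof (intro integral_mono integrable_S integrable_mult_right)
    fix t assume "t \<in> space \<rho>"
    then have "t > 0" by (simp add: space_rho)
    then have "s / (t + s) * (1 / (t + s) ^ n) \<le> 1 * (1 / (t + s) ^ n)"
      using assms by (intro mult_right_mono) auto
    then show "s * (1 / (t + s) ^ Suc n) \<le> 1 / (t + s) ^ n"
      by simp
  qed (use assms in auto)
  finally show ?thesis .
qed

lemma kernel_deriv:
  assumes "t > 0" "y > (0::real)"
  shows "((\<lambda>y. 1 / (t + y) ^ n) has_real_derivative - real n * (1 / (t + y) ^ Suc n)) (at y within X)"
proof (cases n)
  case (Suc k)
  have "((\<lambda>y. 1 / (t + y) ^ n) has_real_derivative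
          - (real n * (t + y) ^ (n - 1)) / ((t + y) ^ n * (t + y) ^ n)) (at y within X)"
    using assms by (auto intro!: derivative_eq_intros)
  also have "- (real n * (t + y) ^ (n - 1)) / ((t + y) ^ n * (t + y) ^ n)
    = - real n * (1 / (t + y) ^ Suc n)"
    using assms unfolding Suc by (simp add: divide_simps)
  finally show ?thesis .
qed simp

lemma S_deriv:
  assumes "n > 0" "s > 0"
  shows "(S n has_real_derivative - real n * S (Suc n) s) (at s)"
proof -
  \<comment> \<open>Staying above \<open>s/2\<close> bounds the derivative of the kernel, and by the
    mean value theorem every difference quotient, by one fixed multiple of \<open>1 / t\<close>, the
    dominating function.\<close>
  define K where "K = {s/2<..}"
  have "((\<lambda>y. (S n y - S n s) / (y - s)) \<longlongrightarrow> - real n * S (Suc n) s) (at s within K)"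
    unfolding tendsto_at_iff_sequentially comp_def
  proof (intro allI impI)
    fix X :: "nat \<Rightarrow> real"
    assume X: "\<forall>i. X i \<in> K - {s}" "X \<longlonglongrightarrow> s"
    have Xpos: "X i > 0" for i using X(1) assms by (auto simp: K_def dest!: spec[of _ i])
    let ?q = "\<lambda>i t. (1 / (t + X i) ^ n - 1 / (t + s) ^ n) / (X i - s)"
    have "(\<lambda>i. \<integral>t. ?q i t \<partial>\<rho>) \<longlonglongrightarrow> (\<integral>t. - real n * (1 / (t + s) ^ Suc n) \<partial>\<rho>)"
    proof (rule integral_dominated_convergence[where w = "\<lambda>t. real n / (s/2) ^ n * (1 / t)"])
      show "integrable \<rho> (\<lambda>t. real n / (s/2) ^ n * (1 / t))"
        by (intro integrable_mult_right integrable_inverse)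
      show "AE t in \<rho>. (\<lambda>i. ?q i t) \<longlonglongrightarrow> - real n * (1 / (t + s) ^ Suc n)"
      proof (rule AE_I2)
        fix t assume "t \<in> space \<rho>"
        then have "((\<lambda>y. (1 / (t + y) ^ n - 1 / (t + s) ^ n) / (y - s))
            \<longlongrightarrow> - real n * (1 / (t + s) ^ Suc n)) (at s within K)"
          using kernel_deriv[of t s n K] assms by (simp add: space_rho has_field_derivative_iff)
        then show "(\<lambda>i. ?q i t) \<longlonglongrightarrow> - real n * (1 / (t + s) ^ Suc n)"
          using X unfolding tendsto_at_iff_sequentially comp_def by blast
      qed
      show "AE t in \<rho>. norm (?q i t) \<le> real n / (s/2) ^ n * (1 / t)" for i
      proof (rule AE_I2)
        fix t assume "t \<in> space \<rho>"
        then have t: "t > 0" by (simp add: space_rho)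
        have "norm (1 / (t + X i) ^ n - 1 / (t + s) ^ n) \<le> (real n / (s/2) ^ n * (1 / t)) * norm (X i - s)"
        proof (rule field_differentiable_bound[of K])
          fix y assume "y \<in> K"
          then have y: "y > s/2" "y > 0" using assms by (auto simp: K_def)
          show "((\<lambda>y. 1 / (t + y) ^ n) has_field_derivative - real n * (1 / (t + y) ^ Suc n)) (at y within K)"
            using kernel_deriv[OF t y(2)] .
          have "1 / (t + y) ^ Suc n \<le> 1 / (t + s/2) ^ Suc n"
            using t y assms by (intro frac_le power_mono) auto
          also have "\<dots> \<le> (1 / (s/2) ^ n) / t"
            using kernel_bound[of "Suc n" "s/2" t] t assms by simp
          finally have "1 / (t + y) ^ Suc n \<le> 1 / (s/2) ^ n * (1 / t)" by simp
          then have "real n * (1 / (t + y) ^ Suc n) \<le> real n * (1 / (s/2) ^ n * (1 / t))"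
            by (rule mult_left_mono) simp
          also have "\<dots> = real n / (s/2) ^ n * (1 / t)" by simp
          finally have "real n * (1 / (t + y) ^ Suc n) \<le> real n / (s/2) ^ n * (1 / t)" .
          moreover have "norm (- real n * (1 / (t + y) ^ Suc n)) = real n * (1 / (t + y) ^ Suc n)"
            using t y abs_of_nonneg[of "real n * (1 / (t + y) ^ Suc n)"]
            by (simp only: real_norm_def mult_minus_left abs_minus_cancel) simp
          ultimately show "norm (- real n * (1 / (t + y) ^ Suc n)) \<le> real n / (s/2) ^ n * (1 / t)"
            by (simp only:)
        qed (use X assms in \<open>auto simp: K_def\<close>)
        then show "norm (?q i t) \<le> real n / (s/2) ^ n * (1 / t)"
          using X(1) by (auto simp: norm_divide divide_le_eq dest!: spec[of _ i])
      qed
    qed (auto intro!: measurable_rho)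
    moreover have "(\<integral>t. ?q i t \<partial>\<rho>) = (S n (X i) - S n s) / (X i - s)" for i
      unfolding S_def using assms Xpos by (simp add: integrable_S)
    moreover have "(\<integral>t. - real n * (1 / (t + s) ^ Suc n) \<partial>\<rho>) = - real n * S (Suc n) s"
      unfolding S_def by (rule integral_mult_right_zero)
    ultimately show "(\<lambda>i. (S n (X i) - S n s) / (X i - s)) \<longlonglongrightarrow> - real n * S (Suc n) s"
      by (simp only:)
  qed
  moreover have "at s within K = at s"
    using assms by (intro at_within_open) (auto simp: K_def)
  ultimately show ?thesis
    by (simp add: has_field_derivative_iff)
qed

lemma S_strict_antimono:
  assumes "n > 0" "0 < s" "s < s'"
  shows "S n s' < S n s"
proof (rule DERIV_neg_imp_decreasing[OF assms(3)])
  fix x assume "s \<le> x"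
  then show "\<exists>y. (S n has_real_derivative y) (at x) \<and> y < 0"
    using S_deriv[of n x] S_pos[of "Suc n" x] assms by (intro exI conjI) auto
qed

lemma S_tendsto_0: "(S 1 \<longlongrightarrow> 0) at_top"
proof -
  have "((\<lambda>s. \<integral>t. 1 / (t + s) ^ 1 \<partial>\<rho>) \<longlongrightarrow> (\<integral>t. 0 \<partial>\<rho>)) at_top"
  proof (rule integral_dominated_convergence_at_top[where w = "\<lambda>t. 1 / t"])
    show "\<forall>\<^sub>F s in at_top. AE t in \<rho>. norm (1 / (t + s) ^ 1) \<le> 1 / t"
      using eventually_gt_at_top[of 0]
      by eventually_elim (auto simp: space_rho intro!: AE_I2 frac_le)
    show "AE t in \<rho>. ((\<lambda>s. 1 / (t + s) ^ 1) \<longlongrightarrow> 0) at_top"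
      by (intro AE_I2) real_asymp
  qed (auto intro!: measurable_rho integrable_inverse)
  then show ?thesis by (simp add: S_def[abs_def])
qed

lemma S_2_tendsto_0: "(S 2 \<longlongrightarrow> 0) at_top"
proof (rule tendsto_sandwich[OF _ _ tendsto_const S_tendsto_0])
  show "\<forall>\<^sub>F s in at_top. S 2 s \<le> S 1 s"
    using eventually_ge_at_top[of 1]
  proof eventually_elim
    case (elim s)
    have "S 2 s \<le> s * S 2 s" using elim S_pos[of 2 s] by simp
    also have "\<dots> \<le> S 1 s" using S_Suc_le[of 1 s] elim by (simp add: numeral_2_eq_2)
    finally show ?case .
  qed
  show "\<forall>\<^sub>F s in at_top. 0 \<le> S 2 s"
    using eventually_gt_at_top[of 0] by eventually_elim (simp add: S_pos less_imp_le)
qed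

end

section \<open>A Tauberian theorem\<close>

locale regular_stieltjes_measure = stieltjes_measure +
  fixes r :: real
  assumes r_less_1: "r < 1"
    and S_ratio: "((\<lambda>x. x * S 2 x / S 1 x) \<longlongrightarrow> 1 - r) at_top"
begin

text \<open>By \<open>V_eq\<close> this is the integral of \<open>x / (x + t)\<close>, a smoothed
  substitute for \<open>U\<close>. Its regular variation follows directly from that of
  \<open>S 1\<close>, and \<open>U\<close> is studied relative to it.\<close>

definition V :: "real \<Rightarrow> real" where "V x = x * S 1 x"

definition U :: "real \<Rightarrow> real" where "U x = measure \<rho> {0<..x}"

lemma V_pos: "x > 0 \<Longrightarrow> V x > 0"
  by (simp add: V_def S_pos)

text \<open>The two claims feed each other. Regular variation of \<open>S n\<close> gives the limit
  of \<open>x * (n * S (Suc n) x) / S n x\<close> by \<open>monotone_density\<close>, since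
  \<open>S (Suc n)\<close> is antitone; that limit \<open>n - r\<close> is nonzero, so
  \<open>S (Suc n) x\<close> is comparable with \<open>S n x / x\<close> and inherits regular
  variation with index lowered by 1.\<close>

lemma S_regular:
  assumes "n > 0"
  shows "(\<forall>l>0. ((\<lambda>x. S n (l * x) / S n x) \<longlongrightarrow> l powr (r - n)) at_top) \<and>
         ((\<lambda>x. x * (n * S (Suc n) x) / S n x) \<longlongrightarrow> n - r) at_top"
proof -
  have density: "((\<lambda>x. x * (n * S (Suc n) x) / S n x) \<longlongrightarrow> n - r) at_top"
    if "n > 0" "\<forall>l>0. ((\<lambda>x. S n (l * x) / S n x) \<longlongrightarrow> l powr (r - n)) at_top" for n :: nat
  proof (rule monotone_density)
    show "(S n has_real_derivative - (real n * S (Suc n) x)) (at x)" if "x > 0" for x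
      using S_deriv[OF \<open>n > 0\<close> that] by simp
    show "real n * S (Suc n) y \<le> real n * S (Suc n) x" if "0 < x" "x \<le> y" for x y
      using S_antimono[of "Suc n" x y] that by (intro mult_left_mono) auto
  qed (use that S_pos in auto)
  show ?thesis
    using assms
  proof (induction n rule: nat_induct_non_zero)
    case 1
    have "((\<lambda>x. x * (- S 2 x) / S 1 x) \<longlongrightarrow> r - 1) at_top"
      using tendsto_minus[OF S_ratio] by simp
    moreover have "(S 1 has_real_derivative - S 2 x) (at x)" if "x > 0" for x
      using S_deriv[of 1 x] that by (simp add: numeral_2_eq_2)
    ultimately have "\<forall>l>0. ((\<lambda>x. S 1 (l * x) / S 1 x) \<longlongrightarrow> l powr (r - real 1)) at_top"
      using ratio_tendsto_if_log_derivative[of "S 1" "\<lambda>x. - S 2 x" "r - 1"] S_pos[of 1] by simp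
    then show ?case using density[of 1] by simp
  next
    case (Suc n)
    have "((\<lambda>x. S (Suc n) (l * x) / S (Suc n) x) \<longlongrightarrow> l powr (r - real (Suc n))) at_top"
      if "l > 0" for l
    proof -
      let ?g = "\<lambda>x. x * (n * S (Suc n) x) / S n x"
      have "n - r > 0" using r_less_1 Suc.hyps by linarith
      have g: "(?g \<longlongrightarrow> n - r) at_top" using Suc.IH by simp
      have mult_at_top: "filterlim (\<lambda>x::real. l * x) at_top at_top"
        using that by (intro filterlim_tendsto_pos_mult_at_top[OF tendsto_const] filterlim_ident)
      have "((\<lambda>x. ?g (l * x) / ?g x * (S n (l * x) / S n x) / l)
          \<longlongrightarrow> (n - r) / (n - r) * l powr (r - n) / l) at_top"
        using Suc.IH that \<open>n - r > 0\<close>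
        by (intro tendsto_intros filterlim_compose[OF g mult_at_top] g) auto
      also have "(n - r) / (n - r) * l powr (r - n) / l = l powr (r - real (Suc n))"
        using \<open>n - r > 0\<close> that by (simp add: powr_diff powr_add divide_simps)
      finally show ?thesis
      proof (rule Lim_transform_eventually)
        show "\<forall>\<^sub>F x in at_top. ?g (l * x) / ?g x * (S n (l * x) / S n x) / l
            = S (Suc n) (l * x) / S (Suc n) x"
          using eventually_gt_at_top[of 0]
        proof eventually_elim
          case (elim x)
          have "S n x > 0" "S n (l * x) > 0" "S (Suc n) x > 0"
            using elim that Suc.hyps by (auto intro!: S_pos)
          then show ?case using elim that Suc.hyps by (simp add: divide_simps)
        qed
      qed
    qed
    then show ?case using density[of "Suc n"] by simp
  qed
qed

lemma V_regular:
  assumes "l > 0"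
  shows "((\<lambda>x. V (l * x) / V x) \<longlongrightarrow> l powr r) at_top"
proof -
  have "((\<lambda>x. l * (S 1 (l * x) / S 1 x)) \<longlongrightarrow> l * l powr (r - 1)) at_top"
    using S_regular[of 1] assms by (intro tendsto_intros) auto
  also have "l * l powr (r - 1) = l powr r"
    using assms by (simp add: powr_diff)
  finally show ?thesis
    by (rule Lim_transform_eventually)
      (use eventually_gt_at_top[of 0] in \<open>eventually_elim, simp add: V_def\<close>)
qed

text \<open>Under \<rho> weighted by \<open>x / (x + t)\<close> and normalised by
  \<open>V x\<close>, the variable \<open>x / (x + t)\<close> has a law on [0, 1]. The quotient here
  is its moment of order \<open>n - 1\<close>.\<close>

lemma moment_tendsto:
  assumes "n > 0"
  shows "\<exists>k. ((\<lambda>x. x ^ n * S n x / V x) \<longlongrightarrow> k) at_top"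
  using assms
proof (induction n rule: nat_induct_non_zero)
  case 1
  have "\<forall>\<^sub>F x in at_top. 1 = x ^ 1 * S 1 x / V x"
    using eventually_gt_at_top[of 0]
  proof eventually_elim
    case (elim x)
    then show ?case using S_pos[of 1 x] by (simp add: V_def)
  qed
  then show ?case by (intro exI) (rule Lim_transform_eventually[OF tendsto_const])
next
  case (Suc n)
  then obtain k where k: "((\<lambda>x. x ^ n * S n x / V x) \<longlongrightarrow> k) at_top" by blast
  have "((\<lambda>x. x ^ n * S n x / V x * (x * (n * S (Suc n) x) / S n x) / n) \<longlongrightarrow> k * (n - r) / n) at_top"
    using S_regular[OF Suc.hyps] Suc.hyps by (intro tendsto_intros k) auto
  moreover have "\<forall>\<^sub>F x in at_top. x ^ n * S n x / V x * (x * (n * S (Suc n) x) / S n x) / n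
      = x ^ Suc n * S (Suc n) x / V x"
    using eventually_gt_at_top[of 0]
  proof eventually_elim
    case (elim x)
    then show ?case using S_pos[of n x] Suc.hyps by simp
  qed
  ultimately show ?case by (intro exI) (rule Lim_transform_eventually)
qed

section \<open>From moments to the distribution function of \<rho>\<close>

lemma integrable_weighted:
  fixes q :: "real \<Rightarrow> real"
  assumes "continuous_on UNIV q" "x > 0"
  shows "integrable \<rho> (\<lambda>t. x / (x + t) * q (x / (x + t)))"
proof -
  have "compact (q ` {0..1})"
    by (intro compact_continuous_image continuous_on_subset[OF assms(1)]) auto
  then have "bounded (q ` {0..1})" by (rule compact_imp_bounded)
  then obtain B where "\<forall>z\<in>q ` {0..1}. norm z \<le> B"
    unfolding bounded_iff by (elim exE)
  then have B: "\<And>y. y \<in> {0..1} \<Longrightarrow> \<bar>q y\<bar> \<le> B" by simp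
  have [measurable]: "q \<in> borel_measurable borel"
    using assms(1) by (rule borel_measurable_continuous_onI)
  show ?thesis
  proof (rule integrable_if_bounded_by_inverse[where C = "x * B"])
    fix t :: real assume "t > 0"
    then have "x / (x + t) \<in> {0..1}" using assms(2) by simp
    then have "\<bar>x / (x + t)\<bar> * \<bar>q (x / (x + t))\<bar> \<le> x / t * B"
      using assms(2) \<open>t > 0\<close> by (intro mult_mono B) (auto intro!: frac_le)
    then show "\<bar>x / (x + t) * q (x / (x + t))\<bar> \<le> x * B / t"
      by (simp add: abs_mult)
  qed simp
qed

lemma V_eq: "x > 0 \<Longrightarrow> V x = (\<integral>t. x / (x + t) \<partial>\<rho>)"
  unfolding V_def S_def
  by (subst integral_mult_right_zero[symmetric]) (simp add: add.commute)

text \<open>For polynomial \<open>q\<close> this is a combination of moments. A uniform error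
  \<open>e\<close> on [0, 1] becomes an error of at most \<open>e * V x\<close> after integration
  against the weight, hence at most \<open>e\<close> after normalisation, whatever \<open>x\<close>
  is.\<close>

lemma weighted_tendsto:
  fixes q :: "real \<Rightarrow> real"
  assumes q: "continuous_on UNIV q"
  obtains l where "((\<lambda>x. (\<integral>t. x / (x + t) * q (x / (x + t)) \<partial>\<rho>) / V x) \<longlongrightarrow> l) at_top"
proof -
  define T where "T q x = (\<integral>t. x / (x + t) * q (x / (x + t)) \<partial>\<rho>)" for q :: "real \<Rightarrow> real" and x
  have "\<exists>g l. (g \<longlongrightarrow> l) at_top \<and> (\<forall>\<^sub>F x in at_top. \<bar>T q x / V x - g x\<bar> \<le> e)" if e: "e > 0" for e
  proof -
    obtain p where p: "real_polynomial_function p" "\<And>y. y \<in> {0..1} \<Longrightarrow> \<bar>q y - p y\<bar> < e"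
      using Stone_Weierstrass_real_polynomial_function
        [OF compact_Icc continuous_on_subset[OF q subset_UNIV] e, of 0 1] by metis
    obtain c k where pc: "p = (\<lambda>y. \<Sum>i\<le>k. c i * y ^ i)"
      using p(1) unfolding real_polynomial_function_iff_sum by blast
    have contp: "continuous_on UNIV p"
      unfolding pc by (intro continuous_intros)
    obtain \<kappa> where \<kappa>: "\<And>n. n > 0 \<Longrightarrow> ((\<lambda>x. x ^ n * S n x / V x) \<longlongrightarrow> \<kappa> n) at_top"
      using moment_tendsto by metis
    \<comment> \<open>The weight contributes one power of \<open>x / (x + t)\<close>, so the
      coefficient of degree \<open>i\<close> meets \<open>S (Suc i)\<close>.\<close>
    have "((\<lambda>x. \<Sum>i\<le>k. c i * (x ^ Suc i * S (Suc i) x / V x)) \<longlongrightarrow> (\<Sum>i\<le>k. c i * \<kappa> (Suc i))) at_top"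
      by (intro tendsto_intros \<kappa>) auto
    moreover have Tp: "T p x / V x = (\<Sum>i\<le>k. c i * (x ^ Suc i * S (Suc i) x / V x))" if "x > 0" for x
    proof -
      have "T p x = (\<integral>t. (\<Sum>i\<le>k. c i * (x ^ Suc i * (1 / (t + x) ^ Suc i))) \<partial>\<rho>)"
        unfolding T_def pc
        by (intro Bochner_Integration.integral_cong refl)
          (simp add: sum_distrib_left power_divide add.commute mult_ac)
      also have "\<dots> = (\<Sum>i\<le>k. \<integral>t. c i * (x ^ Suc i * (1 / (t + x) ^ Suc i)) \<partial>\<rho>)"
        using that by (intro Bochner_Integration.integral_sum integrable_mult_right integrable_S) auto
      also have "\<dots> = (\<Sum>i\<le>k. c i * (x ^ Suc i * S (Suc i) x))"
        unfolding S_def by (simp only: integral_mult_right_zero)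
      finally show ?thesis by (simp add: sum_divide_distrib)
    qed
    have "\<forall>\<^sub>F x in at_top. (\<Sum>i\<le>k. c i * (x ^ Suc i * S (Suc i) x / V x)) = T p x / V x"
      using eventually_gt_at_top[of 0] by eventually_elim (simp only: Tp)
    ultimately have "((\<lambda>x. T p x / V x) \<longlongrightarrow> (\<Sum>i\<le>k. c i * \<kappa> (Suc i))) at_top"
      by (rule Lim_transform_eventually)
    moreover have "\<forall>\<^sub>F x in at_top. \<bar>T q x / V x - T p x / V x\<bar> \<le> e"
      using eventually_gt_at_top[of 0]
    proof eventually_elim
      case (elim x)
      have "\<bar>T q x - T p x\<bar> =
          \<bar>\<integral>t. x / (x + t) * q (x / (x + t)) - x / (x + t) * p (x / (x + t)) \<partial>\<rho>\<bar>"
        unfolding T_def using integrable_weighted[OF q elim] integrable_weighted[OF contp elim]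
        by (simp only: Bochner_Integration.integral_diff)
      also have "\<dots> \<le> (\<integral>t. \<bar>x / (x + t) * q (x / (x + t)) - x / (x + t) * p (x / (x + t))\<bar> \<partial>\<rho>)"
        by (rule integral_abs_bound)
      also have "\<dots> \<le> (\<integral>t. x / (x + t) * e \<partial>\<rho>)"
      proof (rule integral_mono)
        show "integrable \<rho> (\<lambda>t. \<bar>x / (x + t) * q (x / (x + t)) - x / (x + t) * p (x / (x + t))\<bar>)"
          using integrable_weighted[OF q elim] integrable_weighted[OF contp elim]
          by (intro integrable_abs Bochner_Integration.integrable_diff)
        show "integrable \<rho> (\<lambda>t. x / (x + t) * e)"
          by (rule integrable_weighted[of "\<lambda>_. e", OF continuous_on_const elim])
        fix t assume "t \<in> space \<rho>"
        then have t: "t > 0" by (simp add: space_rho)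
        then have "\<bar>q (x / (x + t)) - p (x / (x + t))\<bar> \<le> e"
          using p(2)[of "x / (x + t)"] elim by simp
        then have "x / (x + t) * \<bar>q (x / (x + t)) - p (x / (x + t))\<bar> \<le> x / (x + t) * e"
          using t elim by (intro mult_left_mono) auto
        also have "x / (x + t) * \<bar>q (x / (x + t)) - p (x / (x + t))\<bar> =
            \<bar>x / (x + t) * q (x / (x + t)) - x / (x + t) * p (x / (x + t))\<bar>"
          using t elim abs_mult[of "x / (x + t)" "q (x / (x + t)) - p (x / (x + t))"]
          by (simp only: right_diff_distrib) simp
        finally show "\<bar>x / (x + t) * q (x / (x + t)) - x / (x + t) * p (x / (x + t))\<bar> \<le> x / (x + t) * e" .
      qed
      also have "\<dots> = e * V x"
        unfolding V_eq[OF elim] integral_mult_left_zero by (rule mult.commute)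
      finally have "\<bar>T q x - T p x\<bar> \<le> e * V x" .
      then have "\<bar>T q x - T p x\<bar> / V x \<le> e"
        using V_pos[OF elim] by (simp add: divide_le_eq)
      then show ?case
        using V_pos[OF elim] by (simp add: diff_divide_distrib[symmetric])
    qed
    ultimately show ?thesis by (intro exI conjI)
  qed
  then obtain l where "((\<lambda>x. T q x / V x) \<longlongrightarrow> l) at_top"
    by (rule tendsto_if_approximable[OF trivial_limit_at_top_linorder])
  then show ?thesis unfolding T_def by (rule that)
qed

lemma integrable_indicator_Ioc: "integrable \<rho> (indicator {0<..x} :: real \<Rightarrow> real)"
proof (rule integrable_if_bounded_by_inverse)
  show "\<bar>indicator {0<..x} t :: real\<bar> \<le> \<bar>x\<bar> / t" if "t > 0" for t
    using that by (auto simp: indicator_def field_simps)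
qed simp

lemma U_eq: "U x = (\<integral>t. indicator {0<..x} t \<partial>\<rho>)"
proof -
  have "{0<..x} \<inter> space \<rho> = {0<..x}" by (auto simp: space_rho)
  then show ?thesis by (simp add: U_def)
qed

lemma U_mono: "mono U"
  unfolding U_eq by (intro monoI integral_mono integrable_indicator_Ioc) (auto simp: indicator_def)

lemma integrable_V: "x > 0 \<Longrightarrow> integrable \<rho> (\<lambda>t. x / (x + t))"
  using integrable_weighted[of "\<lambda>_. 1" x] by simp

text \<open>On \<open>t \<le> x\<close> the weight \<open>x / (x + t)\<close> is at least
  1/2.\<close>

lemma U_le: "x > 0 \<Longrightarrow> U x \<le> 2 * V x"
  unfolding U_eq V_eq integral_mult_right_zero[symmetric]
  by (intro integral_mono integrable_indicator_Ioc integrable_mult_right integrable_V)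
    (auto simp: indicator_def field_simps space_rho)

text \<open>A continuous cutoff below the indicator of \<open>{0<..x}\<close> dominates it after rescaling \<open>x\<close>
  by \<open>\<eta>\<close>, and rescaling multiplies its limit by \<open>\<eta> powr r\<close> only. Hence the limit measure
  never has to be identified.\<close>

lemma U_ratio_tendsto:
  obtains l where "((\<lambda>x. U x / V x) \<longlongrightarrow> l) at_top"
proof -
  have "\<exists>g l. (g \<longlongrightarrow> l) at_top \<and> (\<forall>\<^sub>F x in at_top. \<bar>U x / V x - g x\<bar> \<le> e)" if e: "e > 0" for e
  proof -
    \<comment> \<open>\<eta> has to be fixed before the limit \<open>l\<close> of the cutoff
      integrals, which depends on it. The tolerance \<open>e / 4\<close> suffices because
      \<open>l\<close> always lies between 0 and 2, the upper bound coming from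
      \<open>U_le\<close>.\<close>
    have "((\<lambda>\<eta>. \<eta> powr r) \<longlongrightarrow> 1 powr r) (at_right 1)"
      by (intro tendsto_intros) auto
    then have "\<forall>\<^sub>F \<eta> in at_right 1. dist (\<eta> powr r) 1 < e / 4 \<and> \<eta> > 1"
      using tendstoD[of _ 1 _ "e / 4"] e by (auto simp: eventually_conj_iff eventually_at_right_less)
    then obtain \<eta> where \<eta>: "\<bar>\<eta> powr r - 1\<bar> < e / 4" "\<eta> > 1"
      using eventually_happens'[OF trivial_limit_at_right_real] by (auto simp: dist_real_def)
    \<comment> \<open>In the variable \<open>y = x / (x + t)\<close> the condition
      \<open>t \<le> x\<close> reads \<open>1 / 2 \<le> y\<close>. With \<open>x\<close> replaced by
      \<open>\<eta> * x\<close> it becomes \<open>y \<ge> \<eta> / (1 + \<eta>)\<close>. The cutoff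
      \<psi> rises linearly from 0 to 1 between these two values, and \<open>d\<close> is their
      distance.\<close>
    define d where "d = \<eta> / (1 + \<eta>) - 1 / 2"
    have d: "d > 0" using \<eta> by (simp add: d_def field_simps)
    define \<psi> where "\<psi> y = min 1 (max 0 ((y - 1 / 2) / d))" for y :: real
    \<comment> \<open>\<open>weighted_tendsto\<close> needs \<psi> in the form
      \<open>y * q y\<close> with \<open>q\<close> continuous. As \<psi> vanishes for
      \<open>y \<le> 1 / 2\<close>, dividing by \<open>max y (1 / 2)\<close> instead of
      \<open>y\<close> changes nothing and avoids the singularity at 0.\<close>
    define q where "q y = \<psi> y / max y (1 / 2)" for y
    define T where "T x = (\<integral>t. \<psi> (x / (x + t)) \<partial>\<rho>)" for x
    have cq: "continuous_on UNIV q"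
      unfolding q_def \<psi>_def using d by (intro continuous_intros) (auto simp: max_def)
    have yq: "y * q y = \<psi> y" for y
    proof (cases "y \<le> 1 / 2")
      case True
      then have "(y - 1 / 2) / d \<le> 0" using d by (simp add: divide_nonpos_pos)
      then have "\<psi> y = 0" by (simp add: \<psi>_def)
      then show ?thesis by (simp add: q_def)
    qed (simp add: q_def max_def)
    have intT: "integrable \<rho> (\<lambda>t. \<psi> (x / (x + t)))" if "x > 0" for x
      using integrable_weighted[OF cq that] unfolding yq .
    obtain l where l: "((\<lambda>x. T x / V x) \<longlongrightarrow> l) at_top"
      using weighted_tendsto[OF cq] unfolding yq T_def by blast
    have T_le: "T x \<le> U x" if "x > 0" for x
      unfolding T_def U_eq
    proof (intro integral_mono intT integrable_indicator_Ioc that)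
      fix t assume "t \<in> space \<rho>"
      then have "t > 0" by (simp add: space_rho)
      show "\<psi> (x / (x + t)) \<le> indicator {0<..x} t"
      proof (cases "t \<le> x")
        case True
        then show ?thesis using \<open>t > 0\<close> by (simp add: \<psi>_def)
      next
        case False
        then have "x / (x + t) - 1 / 2 \<le> 0" using that by (simp add: field_simps)
        then have "(x / (x + t) - 1 / 2) / d \<le> 0" using d by (simp add: divide_nonpos_pos)
        then show ?thesis by (simp add: \<psi>_def)
      qed
    qed
    have le_T: "U x \<le> T (\<eta> * x)" if "x > 0" for x
    proof -
      have pos: "\<eta> * x > 0" using that \<eta> by simp
      show ?thesis
        unfolding T_def U_eq
      proof (intro integral_mono intT integrable_indicator_Ioc pos)
        fix t assume "t \<in> space \<rho>"
        then have "t > 0" by (simp add: space_rho)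
        show "indicator {0<..x} t \<le> \<psi> (\<eta> * x / (\<eta> * x + t))"
        proof (cases "t \<le> x")
          case True
          have "\<eta> / (1 + \<eta>) = \<eta> * x / (\<eta> * x + x)"
            using that \<eta> mult_divide_mult_cancel_right[of x \<eta> "1 + \<eta>"] by (simp add: algebra_simps)
          also have "\<dots> \<le> \<eta> * x / (\<eta> * x + t)"
            using True \<open>t > 0\<close> pos by (intro divide_left_mono mult_pos_pos) auto
          finally have "1 \<le> (\<eta> * x / (\<eta> * x + t) - 1 / 2) / d"
            using d by (simp add: d_def le_divide_eq)
          then show ?thesis by (simp add: \<psi>_def)
        next
          case False
          then show ?thesis by (simp add: \<psi>_def)
        qed
      qed
    qed
    have "l \<le> 2"
    proof (rule tendsto_upperbound[OF l _ trivial_limit_at_top_linorder])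
      show "\<forall>\<^sub>F x in at_top. T x / V x \<le> 2"
        using eventually_gt_at_top[of 0]
      proof eventually_elim
        case (elim x)
        have "T x \<le> 2 * V x" using T_le[OF elim] U_le[OF elim] by simp
        then show ?case using V_pos[OF elim] by (simp add: divide_le_eq)
      qed
    qed
    moreover have "l \<ge> 0"
    proof (rule tendsto_lowerbound[OF l _ trivial_limit_at_top_linorder])
      show "\<forall>\<^sub>F x in at_top. 0 \<le> T x / V x"
        using eventually_gt_at_top[of 0]
      proof eventually_elim
        case (elim x)
        have "0 \<le> T x" unfolding T_def by (intro Bochner_Integration.integral_nonneg) (simp add: \<psi>_def)
        then show ?case using V_pos[OF elim] by simp
      qed
    qed
    moreover have "\<eta> powr r - 1 \<le> e / 4" using \<eta>(1) by linarith
    moreover have "l * (e / 4) \<le> 2 * (e / 4)"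
      using \<open>l \<le> 2\<close> e by (intro mult_right_mono) auto
    moreover have "l * (\<eta> powr r - 1) \<le> l * (e / 4)" if "l \<ge> 0" "\<eta> powr r - 1 \<le> e / 4"
      using that by (intro mult_left_mono)
    ultimately have "l * (\<eta> powr r - 1) \<le> l * (e / 4)" "l * (e / 4) \<le> 2 * (e / 4)" by blast+
    then have "l * (\<eta> powr r - 1) \<le> 2 * (e / 4)" by linarith
    have mult_at_top: "filterlim (\<lambda>x::real. \<eta> * x) at_top at_top"
      using \<eta> by (intro filterlim_tendsto_pos_mult_at_top[OF tendsto_const] filterlim_ident) auto
    have "((\<lambda>x. T (\<eta> * x) / V (\<eta> * x) * (V (\<eta> * x) / V x) - T x / V x)
        \<longlongrightarrow> l * \<eta> powr r - l) at_top"
      using \<eta> by (intro tendsto_intros filterlim_compose[OF l mult_at_top] l V_regular) auto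
    then have "\<forall>\<^sub>F x in at_top. T (\<eta> * x) / V (\<eta> * x) * (V (\<eta> * x) / V x) - T x / V x < e"
    proof (rule order_tendstoD)
      show "l * \<eta> powr r - l < e"
        using \<open>l * (\<eta> powr r - 1) \<le> 2 * (e / 4)\<close> e by (simp add: algebra_simps)
    qed
    then have "\<forall>\<^sub>F x in at_top. \<bar>U x / V x - T x / V x\<bar> \<le> e"
      using eventually_gt_at_top[of 0]
    proof eventually_elim
      case (elim x)
      have V: "V x > 0" "V (\<eta> * x) > 0" using elim \<eta> by (auto intro!: V_pos)
      have "U x / V x \<le> T (\<eta> * x) / V x"
        using le_T[of x] elim V by (intro divide_right_mono) auto
      moreover have "T x / V x \<le> U x / V x"
        using T_le[of x] elim V by (intro divide_right_mono) auto
      moreover have "T (\<eta> * x) / V (\<eta> * x) * (V (\<eta> * x) / V x) = T (\<eta> * x) / V x"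
        using V by simp
      ultimately show ?case using elim by linarith
    qed
    with l show ?thesis by (intro exI conjI)
  qed
  then obtain l where "((\<lambda>x. U x / V x) \<longlongrightarrow> l) at_top"
    by (rule tendsto_if_approximable[OF trivial_limit_at_top_linorder])
  then show ?thesis by (rule that)
qed

text \<open>Positivity of the limit comes from splitting the integral of the squared weight at
  \<open>t = K * x\<close>. The near part is at most \<open>U (K * x)\<close>; on the far part one
  factor is at most \<open>1 / (K + 1)\<close>, leaving at most \<open>V x / (K + 1)\<close>. The
  whole is asymptotically \<open>(1 - r) * V x\<close>, so for large \<open>K\<close> the near part
  cannot be negligible.\<close>

lemma U_asymptotic:
  obtains l where "l > 0" "((\<lambda>x. U x / V x) \<longlongrightarrow> l) at_top"
proof -
  obtain l where l: "((\<lambda>x. U x / V x) \<longlongrightarrow> l) at_top"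
    by (rule U_ratio_tendsto)
  \<comment> \<open>This makes \<open>1 / (K + 1)\<close> smaller than \<open>1 / K\<close>, which
    is half of \<open>1 - r\<close>.\<close>
  define K where "K = 2 / (1 - r)"
  have "K > 0" using r_less_1 by (simp add: K_def)
  then have "1 / (K + 1) < 1 / K" by (intro divide_strict_left_mono) auto
  then have K: "K > 0" "1 / (K + 1) < 1 - r"
    using \<open>K > 0\<close> r_less_1 by (auto simp: K_def)
  have mult_at_top: "filterlim (\<lambda>x::real. K * x) at_top at_top"
    using K by (intro filterlim_tendsto_pos_mult_at_top[OF tendsto_const] filterlim_ident) auto
  have "((\<lambda>x. U (K * x) / V (K * x) * (V (K * x) / V x) + 1 / (K + 1))
      \<longlongrightarrow> l * K powr r + 1 / (K + 1)) at_top"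
    using K by (intro tendsto_intros filterlim_compose[OF l mult_at_top] V_regular) auto
  moreover have "\<forall>\<^sub>F x in at_top. x * S 2 x / S 1 x
      \<le> U (K * x) / V (K * x) * (V (K * x) / V x) + 1 / (K + 1)"
    using eventually_gt_at_top[of 0]
  proof eventually_elim
    case (elim x)
    have V: "V x > 0" "V (K * x) > 0" "K * x > 0" using elim K by (auto intro!: V_pos)
    have "x * x * S 2 x = (\<integral>t. x * x * (1 / (t + x) ^ 2) \<partial>\<rho>)"
      unfolding S_def by (rule integral_mult_right_zero[symmetric])
    also have "\<dots> \<le> (\<integral>t. indicator {0<..K * x} t + x / (x + t) * (1 / (K + 1)) \<partial>\<rho>)"
    proof (intro integral_mono integrable_mult_right integrable_S
        Bochner_Integration.integrable_add integrable_indicator_Ioc integrable_mult_left integrable_V elim)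
      fix t assume "t \<in> space \<rho>"
      then have "t > 0" by (simp add: space_rho)
      have eq: "x * x * (1 / (t + x) ^ 2) = x / (x + t) * (x / (x + t))"
        by (simp add: power2_eq_square add.commute)
      show "x * x * (1 / (t + x) ^ 2) \<le> indicator {0<..K * x} t + x / (x + t) * (1 / (K + 1))"
      proof (cases "t \<le> K * x")
        case True
        have "x / (x + t) * (x / (x + t)) \<le> 1 * 1"
          using elim \<open>t > 0\<close> by (intro mult_mono) auto
        moreover have "0 \<le> x / (x + t) * (1 / (K + 1))"
          using elim \<open>t > 0\<close> K by (intro mult_nonneg_nonneg) auto
        moreover have "indicator {0<..K * x} t = (1::real)"
          using True \<open>t > 0\<close> by simp
        ultimately show ?thesis unfolding eq by linarith
      next
        case False
        have "x / (x + t) \<le> 1 / (K + 1)"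
          using False elim \<open>t > 0\<close> K by (simp add: field_simps)
        then have "x / (x + t) * (x / (x + t)) \<le> x / (x + t) * (1 / (K + 1))"
          using elim \<open>t > 0\<close> by (intro mult_left_mono) auto
        then show ?thesis unfolding eq using False by simp
      qed
    qed simp_all
    also have "\<dots> = U (K * x) + V x * (1 / (K + 1))"
      unfolding U_eq V_eq[OF elim] integral_mult_left_zero[symmetric]
      by (intro Bochner_Integration.integral_add integrable_indicator_Ioc integrable_mult_left
          integrable_V elim)
    finally have "x * x * S 2 x / V x \<le> (U (K * x) + V x * (1 / (K + 1))) / V x"
      using V by (intro divide_right_mono) auto
    moreover have "x * x * S 2 x / V x = x * S 2 x / S 1 x"
      using elim by (simp add: V_def)
    moreover have "(U (K * x) + V x * (1 / (K + 1))) / V x = U (K * x) / V x + 1 / (K + 1)"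
      using V by (simp add: add_divide_distrib)
    moreover have "U (K * x) / V (K * x) * (V (K * x) / V x) = U (K * x) / V x"
      using V by simp
    ultimately show ?case by linarith
  qed
  ultimately have "1 - r \<le> l * K powr r + 1 / (K + 1)"
    using tendsto_le[OF trivial_limit_at_top_linorder _ S_ratio] by simp
  then have "l * K powr r > 0" using K by linarith
  then have "l > 0" using K by (simp add: zero_less_mult_iff)
  then show ?thesis using l by (rule that)
qed

lemma U_pos_eventually: "\<forall>\<^sub>F x in at_top. U x > 0"
proof -
  obtain l where l: "l > 0" "((\<lambda>x. U x / V x) \<longlongrightarrow> l) at_top"
    by (rule U_asymptotic)
  show ?thesis
    using order_tendstoD(1)[OF l(2,1)] eventually_gt_at_top[of 0]
  proof eventually_elim
    case (elim x)
    then show ?case using V_pos[of x] by (simp add: zero_less_divide_iff)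
  qed
qed

lemma U_regular: "regularly_varying r U"
  unfolding regularly_varying_def
proof (intro conjI allI impI U_pos_eventually)
  show "U \<in> borel_measurable borel" by (rule borel_measurable_mono[OF U_mono])
  fix k :: real assume "k > 0"
  obtain l where l: "l > 0" "((\<lambda>x. U x / V x) \<longlongrightarrow> l) at_top"
    by (rule U_asymptotic)
  have mult_at_top: "filterlim (\<lambda>x::real. k * x) at_top at_top"
    using \<open>k > 0\<close> by (intro filterlim_tendsto_pos_mult_at_top[OF tendsto_const] filterlim_ident) auto
  have "((\<lambda>x. U (k * x) / V (k * x) * (V (k * x) / V x) / (U x / V x))
      \<longlongrightarrow> l * k powr r / l) at_top"
    using \<open>k > 0\<close> l by (intro tendsto_intros filterlim_compose[OF l(2) mult_at_top] l V_regular) auto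
  then have "((\<lambda>x. U (k * x) / V (k * x) * (V (k * x) / V x) / (U x / V x)) \<longlongrightarrow> k powr r) at_top"
    using l by simp
  then show "((\<lambda>x. U (k * x) / U x) \<longlongrightarrow> k powr r) at_top"
  proof (rule Lim_transform_eventually)
    show "\<forall>\<^sub>F x in at_top. U (k * x) / V (k * x) * (V (k * x) / V x) / (U x / V x) = U (k * x) / U x"
      using eventually_gt_at_top[of 0]
    proof eventually_elim
      case (elim x)
      have "V x > 0" "V (k * x) > 0" using elim \<open>k > 0\<close> by (auto intro!: V_pos)
      then show ?case by simp
    qed
  qed
qed

section \<open>Orders of growth\<close>

lemma V_order: "((\<lambda>x. ln (V x) / ln x) \<longlongrightarrow> r) at_top"
\<comment> \<open>This form of the rule asks only the denominator to diverge, so it covers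
  \<open>r = 0\<close>, where \<open>V\<close> may stay bounded.\<close>
proof (rule lhospital_at_top_at_top[OF ln_at_top])
  show "\<forall>\<^sub>F x::real in at_top. 1 / x \<noteq> 0"
    using eventually_gt_at_top[of 0] by eventually_elim simp
  show "\<forall>\<^sub>F x in at_top. (ln has_real_derivative 1 / x) (at x)"
    using eventually_gt_at_top[of 0] by eventually_elim (auto intro!: derivative_eq_intros)
  show "\<forall>\<^sub>F x in at_top. ((\<lambda>x. ln (V x)) has_real_derivative (S 1 x - x * S 2 x) / V x) (at x)"
    using eventually_gt_at_top[of 0]
  proof eventually_elim
    case (elim x)
    have "(S 1 has_real_derivative - S 2 x) (at x)"
      using S_deriv[of 1 x] elim by (simp add: numeral_2_eq_2)
    then have "(V has_real_derivative S 1 x - x * S 2 x) (at x)"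
      unfolding V_def by (auto intro!: derivative_eq_intros)
    then show ?case
      using V_pos[OF elim] by (auto intro!: derivative_eq_intros)
  qed
  have "((\<lambda>x. 1 - x * S 2 x / S 1 x) \<longlongrightarrow> 1 - (1 - r)) at_top"
    by (intro tendsto_intros S_ratio)
  then have "((\<lambda>x. 1 - x * S 2 x / S 1 x) \<longlongrightarrow> r) at_top" by simp
  then show "((\<lambda>x. (S 1 x - x * S 2 x) / V x / (1 / x)) \<longlongrightarrow> r) at_top"
  proof (rule Lim_transform_eventually)
    show "\<forall>\<^sub>F x in at_top. 1 - x * S 2 x / S 1 x = (S 1 x - x * S 2 x) / V x / (1 / x)"
      using eventually_gt_at_top[of 0]
    proof eventually_elim
      case (elim x)
      then show ?case using S_pos[of 1 x] by (simp add: V_def field_simps)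
    qed
  qed
qed

lemma V_order_mult:
  assumes "c > 0" "(f \<longlongrightarrow> c) at_top" "\<forall>\<^sub>F x in at_top. g x = f x * V x"
  shows "((\<lambda>x. ln (g x) / ln x) \<longlongrightarrow> r) at_top"
proof -
  have "((\<lambda>x. ln (f x)) \<longlongrightarrow> ln c) at_top"
    using assms by (intro tendsto_intros) auto
  then have "((\<lambda>x. ln (f x) / ln x + ln (V x) / ln x) \<longlongrightarrow> 0 + r) at_top"
    by (intro tendsto_add V_order real_tendsto_divide_at_top ln_at_top)
  then have "((\<lambda>x. ln (f x) / ln x + ln (V x) / ln x) \<longlongrightarrow> r) at_top" by simp
  then show ?thesis
  proof (rule Lim_transform_eventually)
    show "\<forall>\<^sub>F x in at_top. ln (f x) / ln x + ln (V x) / ln x = ln (g x) / ln x"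
      using eventually_gt_at_top[of 0] order_tendstoD(1)[OF assms(2,1)] assms(3)
    proof eventually_elim
      case (elim x)
      then show ?case
        using V_pos[of x] by (simp add: ln_mult add_divide_distrib)
    qed
  qed
qed

text \<open>The integral lies between \<open>(1 / 2) powr n * U x\<close>, by restricting to
  \<open>t \<le> x\<close>, and \<open>V x\<close>, because a number in [0, 1] decreases when raised
  to a power above 1. Both bounds have logarithmic order \<open>r\<close>, so the upper limit is a
  limit.\<close>

lemma upper_order:
  fixes n :: real
  assumes "n > 1"
  shows "has_upper_order (\<lambda>x. \<integral>t. (x / (x + t)) powr n \<partial>\<rho>) (ereal r)"
proof -
  define f where "f x = (\<integral>t. (x / (x + t)) powr n \<partial>\<rho>)" for x
  have le: "(x / (x + t)) powr n \<le> x / (x + t)" if "x > 0" "t > 0" for x t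
    using powr_mono'[of 1 n "x / (x + t)"] that assms by simp
  have int: "integrable \<rho> (\<lambda>t. (x / (x + t)) powr n)" if "x > 0" for x
  proof (rule integrable_if_bounded_by_inverse[where C = x])
    fix t :: real assume "t > 0"
    have "x / (x + t) \<le> x / t" using that \<open>t > 0\<close> by (intro frac_le) auto
    then show "\<bar>(x / (x + t)) powr n\<bar> \<le> x / t" using le[OF that \<open>t > 0\<close>] by simp
  qed measurable
  have f_pos: "f x > 0" if "x > 0" for x
    unfolding f_def using that by (intro integral_pos int) auto
  have f_le: "f x \<le> V x" if "x > 0" for x
    unfolding f_def V_eq[OF that]
    using le that by (intro integral_mono int integrable_V) (auto simp: space_rho)
  have le_f: "(1 / 2) powr n * U x \<le> f x" if "x > 0" for x
    unfolding f_def U_eq integral_mult_right_zero[symmetric]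
  proof (intro integral_mono int integrable_mult_right integrable_indicator_Ioc that)
    fix t assume "t \<in> space \<rho>"
    then have "t > 0" by (simp add: space_rho)
    have "(1 / 2) powr n \<le> (x / (x + t)) powr n" if "t \<le> x"
      using that \<open>x > 0\<close> \<open>t > 0\<close> assms by (intro powr_mono2) (auto simp: field_simps)
    then show "(1 / 2) powr n * indicator {0<..x} t \<le> (x / (x + t)) powr n"
      by (auto simp: indicator_def)
  qed
  obtain l where l: "l > 0" "((\<lambda>x. U x / V x) \<longlongrightarrow> l) at_top"
    by (rule U_asymptotic)
  have lower: "((\<lambda>x. ln ((1 / 2) powr n * U x) / ln x) \<longlongrightarrow> r) at_top"
  proof (rule V_order_mult)
    show "((\<lambda>x. (1 / 2) powr n * (U x / V x)) \<longlongrightarrow> (1 / 2) powr n * l) at_top"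
      by (intro tendsto_intros l)
    show "\<forall>\<^sub>F x in at_top. (1 / 2) powr n * U x = (1 / 2) powr n * (U x / V x) * V x"
      using eventually_gt_at_top[of 0]
    proof eventually_elim
      case (elim x)
      then show ?case using V_pos[of x] by simp
    qed
  qed (use l in simp)
  have "\<forall>\<^sub>F x in at_top. ln ((1 / 2) powr n * U x) / ln x \<le> ln (f x) / ln x"
    using eventually_gt_at_top[of 1] U_pos_eventually
  proof eventually_elim
    case (elim x)
    then show ?case using le_f[of x] f_pos[of x]
      by (intro divide_right_mono) auto
  qed
  moreover have "\<forall>\<^sub>F x in at_top. ln (f x) / ln x \<le> ln (V x) / ln x"
    using eventually_gt_at_top[of 1]
  proof eventually_elim
    case (elim x)
    then show ?case using f_le[of x] f_pos[of x] V_pos[of x]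
      by (intro divide_right_mono) auto
  qed
  ultimately have "((\<lambda>x. ln (f x) / ln x) \<longlongrightarrow> r) at_top"
    by (rule tendsto_sandwich[OF _ _ lower V_order])
  then have "((\<lambda>x. ereal (ln (f x) / ln x)) \<longlongrightarrow> ereal r) at_top"
    by (rule tendsto_ereal)
  then have "Limsup at_top (\<lambda>x. ereal (ln (f x) / ln x)) = ereal r"
    by (rule lim_imp_Limsup[OF trivial_limit_at_top_linorder])
  then show ?thesis
    unfolding has_upper_order_def f_def[symmetric] using f_pos by blast
qed

end

section \<open>The maximising price\<close>

text \<open>\<open>S_le\<close> expresses \<open>\<Psi> c \<ge> \<xi>\<close>; it keeps the
  denominator \<open>\<mu> - S 1 s + s\<close> of the proportion positive.\<close>

locale stieltjes_game = stieltjes_measure +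
  fixes \<mu> :: real
  assumes S_le: "\<And>s. s > 0 \<Longrightarrow> S 1 s \<le> \<mu>"
begin

text \<open>With \<open>c = s - \<xi>\<close> one has \<open>\<Psi> c = \<xi> + \<mu> - S 1 s\<close>. The proportion \<open>(\<Psi> c - m) / (\<Psi> c + c)\<close> is
  stationary in \<open>c\<close> iff \<open>m = \<xi> + mpar s\<close>, which is how the maximising \<open>s\<close> parametrises \<open>m\<close>.\<close>

definition mpar :: "real \<Rightarrow> real" where
  "mpar s = (\<mu> - S 1 s - s * S 2 s) / (1 + S 2 s)"

lemma S1_deriv: "s > 0 \<Longrightarrow> (S 1 has_real_derivative - S 2 s) (at s)"
  using S_deriv[of 1 s] by (simp add: numeral_2_eq_2)

lemma S2_deriv: "s > 0 \<Longrightarrow> (S 2 has_real_derivative - (2 * S 3 s)) (at s)"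
  using S_deriv[of 2 s] by (simp add: numeral_3_eq_3 numeral_2_eq_2)

text \<open>By \<open>maximizer_eq\<close> the right-hand side is the maximising price; the
  left-hand side is the form whose asymptotics can be read off.\<close>

lemma mpar_stationary: "s > 0 \<Longrightarrow> S 2 s * (s + mpar s) = \<mu> - S 1 s - mpar s"
  using S_pos[of 2 s] by (simp add: mpar_def field_simps)

lemma add_mpar_eq: "s > 0 \<Longrightarrow> s + mpar s = (s + \<mu> - S 1 s) / (1 + S 2 s)"
  using S_pos[of 2 s] by (simp add: mpar_def field_simps)

lemma add_mpar_pos: "s > 0 \<Longrightarrow> s + mpar s > 0"
  using S_pos[of 2 s] S_le[of s] by (simp add: add_mpar_eq)

text \<open>In the numerator \<open>\<mu> - S 1 s - s * S 2 s\<close> the derivative of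
  \<open>S 1\<close> cancels one term of the product rule, leaving \<open>2 * s * S 3 s\<close>.
  What remains, including the derivative of the denominator, carries the factor
  \<open>S 3 s\<close>, which makes the sign visible.\<close>

lemma mpar_deriv:
  assumes "s > 0"
  shows "(mpar has_real_derivative 2 * S 3 s * (s + mpar s) / (1 + S 2 s)) (at s)"
proof -
  have pos: "1 + S 2 s \<noteq> 0" using S_pos[of 2 s] assms by simp
  have "(mpar has_real_derivative
      ((- (- S 2 s) - (S 2 s - s * (2 * S 3 s))) * (1 + S 2 s)
        - (\<mu> - S 1 s - s * S 2 s) * (- (2 * S 3 s))) / ((1 + S 2 s) * (1 + S 2 s))) (at s)"
    unfolding mpar_def
    by (rule derivative_eq_intros S1_deriv S2_deriv assms pos refl | simp)+
  also have "((- (- S 2 s) - (S 2 s - s * (2 * S 3 s))) * (1 + S 2 s)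
        - (\<mu> - S 1 s - s * S 2 s) * (- (2 * S 3 s))) / ((1 + S 2 s) * (1 + S 2 s))
      = 2 * S 3 s * ((s + \<mu> - S 1 s) / (1 + S 2 s)) / (1 + S 2 s)"
    using pos by (simp add: divide_simps) algebra
  finally show ?thesis
    by (simp only: add_mpar_eq[OF assms])
qed

lemma mpar_deriv_pos: "s > 0 \<Longrightarrow> 2 * S 3 s * (s + mpar s) / (1 + S 2 s) > 0"
  using S_pos[of 2 s] S_pos[of 3 s] add_mpar_pos[of s] by simp

lemma mpar_strict_mono:
  assumes "0 < s" "s < s'"
  shows "mpar s < mpar s'"
proof (rule DERIV_pos_imp_increasing[OF assms(2)])
  fix x assume "s \<le> x"
  then have "x > 0" using assms by simp
  then show "\<exists>y. (mpar has_real_derivative y) (at x) \<and> y > 0"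
    using mpar_deriv mpar_deriv_pos by blast
qed

lemma times_S2_tendsto_0: "((\<lambda>s. s * S 2 s) \<longlongrightarrow> 0) at_top"
proof (rule tendsto_sandwich[OF _ _ tendsto_const S_tendsto_0])
  show "\<forall>\<^sub>F s in at_top. s * S 2 s \<le> S 1 s"
    using eventually_gt_at_top[of 0]
  proof eventually_elim
    case (elim s)
    then show ?case using S_Suc_le[of 1 s] by (simp add: numeral_2_eq_2)
  qed
  show "\<forall>\<^sub>F s in at_top. 0 \<le> s * S 2 s"
    using eventually_gt_at_top[of 0] by eventually_elim (simp add: S_pos less_imp_le)
qed

lemma mpar_tendsto: "(mpar \<longlongrightarrow> \<mu>) at_top"
proof -
  have "(mpar \<longlongrightarrow> (\<mu> - 0 - 0) / (1 + 0)) at_top"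
    unfolding mpar_def by (intro tendsto_intros S_tendsto_0 S_2_tendsto_0 times_S2_tendsto_0) simp
  then show ?thesis by simp
qed

lemma continuous_on_mpar: "continuous_on {0<..} mpar"
  by (intro continuous_at_imp_continuous_on ballI DERIV_isCont[OF mpar_deriv]) simp

lemma continuous_on_S1: "continuous_on {0<..} (S 1)"
  by (intro continuous_at_imp_continuous_on ballI DERIV_isCont[OF S1_deriv]) simp

text \<open>The equation \<open>\<mu> - S 1 s' = mpar s + u\<close> makes the price an increasing
  function of \<open>s'\<close>, so monotonicity of \<open>T\<close> in the price is monotonicity of
  \<tau> in \<open>s'\<close>. The latter changes from increasing to decreasing exactly at
  \<open>s' = s\<close>.\<close>

lemma maximizer_eq:
  fixes T :: "real \<Rightarrow> real"
  assumes s: "s > 0" and large: "\<mu> - S 1 1 < mpar s"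
    and T: "\<And>u s'. s' > 0 \<Longrightarrow> u > 0 \<Longrightarrow> \<mu> - S 1 s' = mpar s + u \<Longrightarrow> T u = u / (s' + mpar s + u)"
  shows "(THE v. 0 < v \<and> v < \<mu> - mpar s \<and> strict_mono_on {0<..<v} T \<and>
            strict_antimono_on {u. v < u \<and> u < \<mu> - mpar s} T) = \<mu> - S 1 s - mpar s"
proof -
  define m where "m = mpar s"
  define v where "v = \<mu> - S 1 s - m"
  define \<tau> where "\<tau> x = (\<mu> - S 1 x - m) / (\<mu> - S 1 x + x)" for x
  \<comment> \<open>This is the numerator of the derivative of \<tau> after cancellation. Its own
    derivative is \<open>- 2 * S 3 x * (x + m)\<close>, so it is strictly decreasing and its zero
    \<open>s\<close> is the only sign change.\<close>
  define K where "K x = S 2 x * (x + m) + S 1 x - (\<mu> - m)" for x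
  have "m > 0" using large S_le[of 1] by (simp add: m_def)
  have K0: "K s = 0" using mpar_stationary[OF s] by (simp add: K_def m_def)
  have K_anti: "K y < K x" if "0 < x" "x < y" for x y
  proof (rule DERIV_neg_imp_decreasing[OF that(2)])
    fix z assume "x \<le> z"
    then have z: "z > 0" using that by simp
    have "(K has_real_derivative - (2 * S 3 z) * (z + m)) (at z)"
      unfolding K_def by (rule derivative_eq_intros S1_deriv S2_deriv z refl | simp)+
    moreover have "- (2 * S 3 z) * (z + m) < 0"
      using S_pos[of 3 z] z \<open>m > 0\<close> by simp
    ultimately show "\<exists>d. (K has_real_derivative d) (at z) \<and> d < 0" by blast
  qed
  have den: "\<mu> - S 1 x + x > 0" if "x > 0" for x
    using S_le[OF that] that by simp
  have d\<tau>: "(\<tau> has_real_derivative K x / (\<mu> - S 1 x + x)\<^sup>2) (at x)" if "x > 0" for x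
  proof -
    have nz: "\<mu> - S 1 x + x \<noteq> 0" using den[OF that] by simp
    have "(\<tau> has_real_derivative ((- (- S 2 x)) * (\<mu> - S 1 x + x)
        - (\<mu> - S 1 x - m) * (- (- S 2 x) + 1)) / ((\<mu> - S 1 x + x) * (\<mu> - S 1 x + x))) (at x)"
      unfolding \<tau>_def by (rule derivative_eq_intros S1_deriv that nz refl | simp)+
    also have "((- (- S 2 x)) * (\<mu> - S 1 x + x) - (\<mu> - S 1 x - m) * (- (- S 2 x) + 1)) = K x"
      by (simp add: K_def algebra_simps)
    finally show ?thesis by (simp add: power2_eq_square)
  qed
  have \<tau>_mono: "\<tau> x < \<tau> y" if "0 < x" "x < y" "y < s" for x y
  proof (rule DERIV_pos_imp_increasing[OF that(2)])
    fix z assume "x \<le> z" "z \<le> y"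
    then have "K z > 0" "z > 0" using K_anti[of z s] K0 that by auto
    then show "\<exists>d. (\<tau> has_real_derivative d) (at z) \<and> d > 0"
      using d\<tau>[of z] den[of z] by (intro exI conjI) (assumption, simp)
  qed
  have \<tau>_anti: "\<tau> y < \<tau> x" if "s < x" "x < y" for x y
  proof (rule DERIV_neg_imp_decreasing[OF that(2)])
    fix z assume "x \<le> z" "z \<le> y"
    then have "K z < 0" "z > 0" using K_anti[of s z] K0 that s by auto
    then show "\<exists>d. (\<tau> has_real_derivative d) (at z) \<and> d < 0"
      using d\<tau>[of z] den[of z] by (intro exI conjI) (assumption, simp add: divide_neg_pos)
  qed
  \<comment> \<open>At \<open>x = 1\<close> the value \<open>\<mu> - S 1 x\<close> is below
    \<open>m\<close> by \<open>large\<close>, and it tends to \<mu> at infinity, so it passes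
    through \<open>m + u\<close>. Thus no analysis near \<open>x = 0\<close> is required.\<close>
  have "\<exists>x>0. \<mu> - S 1 x = m + u \<and> T u = \<tau> x" if u: "0 < u" "u < \<mu> - m" for u
  proof -
    have "\<forall>\<^sub>F x in at_top. S 1 x < \<mu> - m - u \<and> x > 1"
      using order_tendstoD(2)[OF S_tendsto_0, of "\<mu> - m - u"] eventually_gt_at_top[of 1] that
      by (intro eventually_conj) auto
    then obtain y where y: "S 1 y < \<mu> - m - u" "y > 1"
      using eventually_happens'[OF trivial_limit_at_top_linorder] by blast
    have "continuous_on {1..y} (S 1)"
      by (rule continuous_on_subset[OF continuous_on_S1]) auto
    then obtain x where x: "1 \<le> x" "S 1 x = \<mu> - m - u"
      using IVT2'[of "S 1" y "\<mu> - m - u" 1] y u large by (auto simp: m_def)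
    then have "T u = u / (x + m + u)"
      using T[of x u] that by (simp add: m_def)
    moreover have "\<tau> x = u / (x + m + u)"
      unfolding \<tau>_def x(2) by (simp add: algebra_simps)
    ultimately show ?thesis using x by (intro exI[of _ x]) auto
  qed
  then obtain \<sigma> where \<sigma>: "\<And>u. 0 < u \<Longrightarrow> u < \<mu> - m \<Longrightarrow> \<sigma> u > 0 \<and> \<mu> - S 1 (\<sigma> u) = m + u \<and> T u = \<tau> (\<sigma> u)"
    by metis
  have order: "x < y" if "0 < x" "0 < y" "\<mu> - S 1 x < \<mu> - S 1 y" for x y
    using that S_antimono[of 1 y x] by (cases "y \<le> x") auto
  have "S 2 s * (s + mpar s) > 0" using S_pos[of 2 s] add_mpar_pos[OF s] s by simp
  then have v: "0 < v" "v < \<mu> - m"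
    using mpar_stationary[OF s] S_pos[of 1 s] s by (auto simp: v_def m_def)
  have inc: "strict_mono_on {0<..<v} T"
  proof (rule strict_mono_onI)
    fix x y assume xy: "x \<in> {0<..<v}" "y \<in> {0<..<v}" "x < y"
    then have \<sigma>x: "\<sigma> x > 0 \<and> \<mu> - S 1 (\<sigma> x) = m + x \<and> T x = \<tau> (\<sigma> x)"
      and \<sigma>y: "\<sigma> y > 0 \<and> \<mu> - S 1 (\<sigma> y) = m + y \<and> T y = \<tau> (\<sigma> y)"
      using \<sigma> v by auto
    have "\<sigma> x < \<sigma> y" using \<sigma>x \<sigma>y xy by (intro order[of "\<sigma> x" "\<sigma> y"]) auto
    moreover have "\<sigma> y < s" using \<sigma>y xy s by (intro order[of "\<sigma> y" s]) (auto simp: v_def)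
    ultimately show "T x < T y" using \<sigma>x \<sigma>y \<tau>_mono by auto
  qed
  have dec: "strict_antimono_on {u. v < u \<and> u < \<mu> - m} T"
  proof (rule monotone_onI)
    fix x y assume xy: "x \<in> {u. v < u \<and> u < \<mu> - m}" "y \<in> {u. v < u \<and> u < \<mu> - m}" "x < y"
    then have \<sigma>x: "\<sigma> x > 0 \<and> \<mu> - S 1 (\<sigma> x) = m + x \<and> T x = \<tau> (\<sigma> x)"
      and \<sigma>y: "\<sigma> y > 0 \<and> \<mu> - S 1 (\<sigma> y) = m + y \<and> T y = \<tau> (\<sigma> y)"
      using \<sigma> v by auto
    have "\<sigma> x < \<sigma> y" using \<sigma>x \<sigma>y xy by (intro order[of "\<sigma> x" "\<sigma> y"]) auto
    moreover have "s < \<sigma> x" using \<sigma>x xy s by (intro order[of s "\<sigma> x"]) (auto simp: v_def)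
    ultimately show "T x > T y" using \<sigma>x \<sigma>y \<tau>_anti by auto
  qed
  \<comment> \<open>Two candidates \<open>x < y\<close> for the maximising price would make
    \<open>T\<close> both increasing and decreasing between them.\<close>
  have clash: False
    if xy: "0 < x" "x < y" "y < \<mu> - m" "strict_mono_on {0<..<y} T"
      "strict_antimono_on {u. x < u \<and> u < \<mu> - m} T" for x y
  proof -
    obtain p where "x < p" "p < y" using dense[OF xy(2)] by blast
    moreover from dense[OF this(2)] obtain q where "p < q" "q < y" by blast
    ultimately have pq: "x < p" "p < q" "q < y" by auto
    have "T p < T q"
      using pq xy(1) by (intro strict_mono_onD[OF xy(4)]) auto
    moreover have "T p > T q"
      using pq xy(3) by (intro monotone_onD[OF xy(5)]) auto
    ultimately show False by simp
  qed
  show ?thesis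
    unfolding m_def[symmetric] v_def[symmetric]
  proof (rule the_equality)
    show "0 < v \<and> v < \<mu> - m \<and> strict_mono_on {0<..<v} T \<and>
        strict_antimono_on {u. v < u \<and> u < \<mu> - m} T"
      using v inc dec by blast
    fix w assume "0 < w \<and> w < \<mu> - m \<and> strict_mono_on {0<..<w} T \<and>
        strict_antimono_on {u. w < u \<and> u < \<mu> - m} T"
    then show "w = v"
      using clash[of w v] clash[of v w] v inc dec by (meson linorder_neqE)
  qed
qed

end

section \<open>Games\<close>

locale centred_game = prob_space M for M :: "'a measure" +
  fixes b :: "'a \<Rightarrow> real"
  assumes integrable_b: "integrable M b"
    and AE_nonneg: "AE x in M. 0 \<le> b x"
    and nonconst: "\<not> (\<exists>k. AE x in M. b x = k)"
begin

definition mean :: real where "mean = (\<integral>x. b x \<partial>M)"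

definition h :: "real \<Rightarrow> real" where "h s = (\<integral>x. inverse (b x + s) \<partial>M)"

text \<open>With \<open>b = a - \<xi>\<close> this is
  \<open>\<Psi> (s - \<xi>) - \<xi>\<close>.\<close>

definition Phi :: "real \<Rightarrow> real" where "Phi s = 1 / h s - s"

lemma measurable_b [measurable]: "b \<in> borel_measurable M"
  using integrable_b by simp

lemma mean_nonneg: "mean \<ge> 0"
  unfolding mean_def by (rule integral_nonneg_AE[OF AE_nonneg])

lemma integrable_h:
  assumes "s > 0"
  shows "integrable M (\<lambda>x. inverse (b x + s))"
proof (rule integrable_const_bound[where B = "inverse s"])
  show "AE x in M. norm (inverse (b x + s)) \<le> inverse s"
    using AE_nonneg by eventually_elim (use assms in \<open>simp add: le_imp_inverse_le\<close>)
qed measurable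

text \<open>Strict Jensen, by integrating \<open>(b - mean)\<^sup>2 / (b + s)\<close>.\<close>

lemma h_gt:
  assumes "s > 0"
  shows "h s > 1 / (mean + s)"
proof -
  \<comment> \<open>The square is expanded around \<open>b x + s\<close> and
    \<open>mean + s\<close>, so that only \<open>b\<close> and the integrand of \<open>h\<close>
    have to be integrated.\<close>
  define g where "g x = (b x + s) - 2 * (mean + s) + (mean + s)\<^sup>2 * inverse (b x + s)" for x
  have pos: "mean + s > 0" using assms mean_nonneg by simp
  have g_eq: "AE x in M. g x = (b x - mean)\<^sup>2 * inverse (b x + s)"
    using AE_nonneg
  proof eventually_elim
    case (elim x)
    have "g x = ((b x + s) * (b x + s) - 2 * (mean + s) * (b x + s) + (mean + s)\<^sup>2) * inverse (b x + s)"
      using elim assms by (simp add: g_def field_simps)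
    also have "(b x + s) * (b x + s) - 2 * (mean + s) * (b x + s) + (mean + s)\<^sup>2 = (b x - mean)\<^sup>2"
      by (simp add: power2_eq_square algebra_simps)
    finally show ?case .
  qed
  have int: "integrable M g"
    unfolding g_def using integrable_b integrable_h[OF assms] by simp
  have nonneg: "AE x in M. 0 \<le> g x"
    using g_eq AE_nonneg by eventually_elim (use assms in simp)
  have "(\<integral>x. g x \<partial>M) = - (mean + s) + (mean + s)\<^sup>2 * h s"
    unfolding g_def h_def using integrable_b integrable_h[OF assms]
    by (simp add: mean_def prob_space)
  moreover have "(\<integral>x. g x \<partial>M) \<noteq> 0"
  proof
    assume "(\<integral>x. g x \<partial>M) = 0"
    then have "AE x in M. g x = 0"
      using integral_nonneg_eq_0_iff_AE[OF int nonneg] by simp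
    then have "AE x in M. b x = mean"
      using g_eq AE_nonneg by eventually_elim (use assms in auto)
    then show False using nonconst by blast
  qed
  moreover have "(\<integral>x. g x \<partial>M) \<ge> 0" by (rule integral_nonneg_AE[OF nonneg])
  ultimately have "(mean + s) * ((mean + s) * h s) > (mean + s) * 1"
    by (simp add: power2_eq_square)
  then have "(mean + s) * h s > 1" using pos by (simp only: mult_less_cancel_left_pos)
  then show ?thesis using pos by (simp add: field_simps)
qed

lemma h_pos: "s > 0 \<Longrightarrow> h s > 0"
  using h_gt[of s] mean_nonneg by (smt (verit) divide_pos_pos)

lemma Phi_less_mean:
  assumes "s > 0"
  shows "Phi s < mean"
proof -
  have "1 < h s * (mean + s)"
    using h_gt[OF assms] assms mean_nonneg by (simp add: field_simps)
  then show ?thesis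
    using h_pos[OF assms] by (simp add: Phi_def field_simps)
qed

text \<open>Both terms of \<open>1 / h s - s\<close> diverge. Rewritten as the integral of
  \<open>b * s / (b + s)\<close> over that of \<open>s / (b + s)\<close>, the expression has two
  dominated limits, \<open>mean\<close> and 1.\<close>

lemma Phi_tendsto_mean: "(Phi \<longlongrightarrow> mean) at_top"
proof -
  have "((\<lambda>s. \<integral>x. b x * (s * inverse (b x + s)) \<partial>M) \<longlongrightarrow> (\<integral>x. b x \<partial>M)) at_top"
  proof (rule integral_dominated_convergence_at_top[where w = b])
    show "\<forall>\<^sub>F s in at_top. AE x in M. norm (b x * (s * inverse (b x + s))) \<le> b x"
      using eventually_gt_at_top[of 0]
    proof eventually_elim
      case (elim s)
      show ?case
        using AE_nonneg
      proof eventually_elim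
        fix x assume "0 \<le> b x"
        then have "s * inverse (b x + s) \<le> 1" using elim by (simp add: field_simps)
        then have "b x * (s * inverse (b x + s)) \<le> b x * 1"
          using \<open>0 \<le> b x\<close> by (rule mult_left_mono)
        then show "norm (b x * (s * inverse (b x + s))) \<le> b x"
          using elim \<open>0 \<le> b x\<close> by simp
      qed
    qed
    show "AE x in M. ((\<lambda>s. b x * (s * inverse (b x + s))) \<longlongrightarrow> b x) at_top"
      by (intro AE_I2) real_asymp
  qed (auto simp: integrable_b)
  moreover have "((\<lambda>s. \<integral>x. s * inverse (b x + s) \<partial>M) \<longlongrightarrow> (\<integral>x. 1 \<partial>M)) at_top"
  proof (rule integral_dominated_convergence_at_top[where w = "\<lambda>_. 1"])
    show "\<forall>\<^sub>F s in at_top. AE x in M. norm (s * inverse (b x + s)) \<le> 1"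
      using eventually_gt_at_top[of 0]
    proof eventually_elim
      case (elim s)
      show ?case
        using AE_nonneg by eventually_elim (use elim in \<open>simp add: field_simps\<close>)
    qed
    show "AE x in M. ((\<lambda>s. s * inverse (b x + s)) \<longlongrightarrow> 1) at_top"
      by (intro AE_I2) real_asymp
  qed auto
  ultimately have "((\<lambda>s. (\<integral>x. b x * (s * inverse (b x + s)) \<partial>M) / (\<integral>x. s * inverse (b x + s) \<partial>M))
      \<longlongrightarrow> mean / 1) at_top"
    unfolding mean_def by (intro tendsto_divide) (auto simp: prob_space)
  then have "((\<lambda>s. (\<integral>x. b x * (s * inverse (b x + s)) \<partial>M) / (\<integral>x. s * inverse (b x + s) \<partial>M))
      \<longlongrightarrow> mean) at_top" by simp
  then show ?thesis
  proof (rule Lim_transform_eventually)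
    show "\<forall>\<^sub>F s in at_top. (\<integral>x. b x * (s * inverse (b x + s)) \<partial>M) / (\<integral>x. s * inverse (b x + s) \<partial>M) = Phi s"
      using eventually_gt_at_top[of 0]
    proof eventually_elim
      case (elim s)
      have "(\<integral>x. b x * (s * inverse (b x + s)) \<partial>M) = (\<integral>x. s * (1 - s * inverse (b x + s)) \<partial>M)"
      proof (rule integral_cong_AE)
        show "AE x in M. b x * (s * inverse (b x + s)) = s * (1 - s * inverse (b x + s))"
          using AE_nonneg by eventually_elim (use elim in \<open>simp add: field_simps\<close>)
      qed measurable
      also have "\<dots> = s * (1 - s * h s)"
        unfolding h_def using integrable_h[OF elim] by (simp add: prob_space)
      finally have num: "(\<integral>x. b x * (s * inverse (b x + s)) \<partial>M) = s * (1 - s * h s)" .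
      have den: "(\<integral>x. s * inverse (b x + s) \<partial>M) = s * h s"
        unfolding h_def by (rule integral_mult_right_zero)
      show ?case
        unfolding num den using elim h_pos[OF elim] by (simp add: Phi_def field_simps)
    qed
  qed
qed

text \<open>The substitution turns the denominator into \<open>t * (b x + s)\<close> and the
  numerator into \<open>(b x + s) - u / t\<close>. The integral therefore vanishes iff
  \<open>1 / h s = u / t\<close>, that is, iff \<open>Phi s = m + u\<close>. The admissible range
  \<open>t < u / (u + m)\<close> is exactly \<open>s > 0\<close>.\<close>

lemma first_order_condition:
  assumes "t > 0" and s: "s = u / t - m - u" "s > 0"
  shows "(\<integral>x. (b x - m - u) / ((b x - m) * t - t * u + u) \<partial>M) = (1 - u / t * h s) / t"
proof -
  have "(\<integral>x. (b x - m - u) / ((b x - m) * t - t * u + u) \<partial>M)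
      = (\<integral>x. (1 - u / t * inverse (b x + s)) / t \<partial>M)"
  proof (rule integral_cong_AE)
    show "AE x in M. (b x - m - u) / ((b x - m) * t - t * u + u) = (1 - u / t * inverse (b x + s)) / t"
      using AE_nonneg
    proof eventually_elim
      case (elim x)
      have den: "(b x - m) * t - t * u + u = t * (b x + s)"
        using \<open>t > 0\<close> by (simp add: s field_simps)
      have num: "b x - m - u = (b x + s) - u / t" by (simp add: s)
      have "b x + s > 0" using elim s by simp
      then show ?case
        unfolding den unfolding num using \<open>t > 0\<close> by (simp add: divide_simps)
    qed
  qed measurable
  also have "\<dots> = (1 - u / t * h s) / t"
    unfolding h_def using integrable_h[OF s(2)] by (simp add: prob_space)
  finally show ?thesis .
qed

lemma optimal_proportion_eq:
  assumes pos: "s > 0" "u > 0" "m > 0" and Phi: "Phi s = m + u"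
    and inj: "\<And>s'. s' > 0 \<Longrightarrow> Phi s' = m + u \<Longrightarrow> s' = s"
  shows "(THE t. 0 < t \<and> t < u / (u + m) \<and>
      (\<integral>x. (b x - m - u) / ((b x - m) * t - t * u + u) \<partial>M) = 0) = u / (s + m + u)"
proof (rule the_equality)
  define t where "t = u / (s + m + u)"
  have t: "t > 0" "u / t = s + m + u" using pos by (auto simp: t_def)
  have "h s * (s + m + u) = 1"
    using Phi h_pos[OF \<open>s > 0\<close>] by (simp add: Phi_def field_simps)
  then have "(\<integral>x. (b x - m - u) / ((b x - m) * t - t * u + u) \<partial>M) = 0"
    using first_order_condition[of t s u m] t \<open>s > 0\<close> by (simp add: mult.commute)
  moreover have "t < u / (u + m)"
    unfolding t_def using pos by (intro divide_strict_left_mono) auto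
  ultimately show "0 < u / (s + m + u) \<and> u / (s + m + u) < u / (u + m) \<and>
      (\<integral>x. (b x - m - u) / ((b x - m) * (u / (s + m + u)) - u / (s + m + u) * u + u) \<partial>M) = 0"
    using t(1) unfolding t_def by blast
next
  fix t assume t: "0 < t \<and> t < u / (u + m) \<and>
      (\<integral>x. (b x - m - u) / ((b x - m) * t - t * u + u) \<partial>M) = 0"
  define s' where "s' = u / t - m - u"
  have "t * (u + m) < u" using t pos by (simp add: pos_less_divide_eq)
  then have "s' > 0" using t by (simp add: s'_def field_simps)
  then have "(1 - u / t * h s') / t = 0"
    using first_order_condition[of t s' u m] t by (simp add: s'_def)
  then have "1 - u / t * h s' = 0" using t by (simp only: divide_eq_0_iff) auto
  then have "u / t * h s' = 1" by linarith
  then have "u / t = 1 / h s'"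
    using h_pos[OF \<open>s' > 0\<close>] pos by (simp add: nonzero_eq_divide_eq)
  then have "Phi s' = m + u" by (simp add: Phi_def s'_def)
  then have "s' = s" using inj \<open>s' > 0\<close> by blast
  then have "u / t = s + m + u" by (simp add: s'_def)
  then show "t = u / (s + m + u)"
    using t pos by (metis divide_divide_eq_right nonzero_mult_div_cancel_left less_irrefl)
qed

end

section \<open>The representing measure of a game with finite mean\<close>

locale represented_game = centred_game M b + half_line_measure \<rho>
  for M :: "'a measure" and b :: "'a \<Rightarrow> real" and \<rho> :: "real measure" +
  fixes A :: real
  assumes finite_rho: "(\<integral>\<^sup>+t. ennreal (1 / (t * (t + 1))) \<partial>\<rho>) < \<infinity>"
    and A_nonneg: "A \<ge> 0"
    and Phi_eq: "\<And>s. s > 0 \<Longrightarrow> Phi s = A + (\<integral>t. s / (t * (t + s)) \<partial>\<rho>)"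
begin

lemma integrable_Phi_kernel:
  assumes "s > 0"
  shows "integrable \<rho> (\<lambda>t. s / (t * (t + s)))"
proof (rule Bochner_Integration.integrable_bound)
  have "integrable \<rho> (\<lambda>t. 1 / (t * (t + 1)))"
    using finite_rho by (intro integrableI_nonneg measurable_rho AE_I2) (auto simp: space_rho)
  then show "integrable \<rho> (\<lambda>t. max 1 s * (1 / (t * (t + 1))))"
    by (rule integrable_mult_right)
  show "AE t in \<rho>. norm (s / (t * (t + s))) \<le> norm (max 1 s * (1 / (t * (t + 1))))"
  proof (rule AE_I2)
    fix t assume "t \<in> space \<rho>"
    then have t: "t > 0" by (simp add: space_rho)
    have "s * (t + 1) \<le> max 1 s * (t + s)"
    proof (cases "s \<le> 1")
      case True
      then have "s * t \<le> 1 * t" using t by (intro mult_right_mono) auto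
      then show ?thesis using True by (simp add: max_def algebra_simps)
    next
      case False
      then show ?thesis by (simp add: max_def)
    qed
    then have "s / (t + s) \<le> max 1 s / (t + 1)"
      using t assms by (simp add: field_simps)
    then have "s / (t + s) / t \<le> max 1 s / (t + 1) / t"
      using t by (intro divide_right_mono) auto
    then show "norm (s / (t * (t + s))) \<le> norm (max 1 s * (1 / (t * (t + 1))))"
      using t assms by (simp add: mult.commute)
  qed
qed (auto intro!: measurable_rho)

text \<open>As \<open>s\<close> runs through the positive integers, the kernel
  \<open>s / (t * (t + s))\<close> increases to \<open>1 / t\<close>, while its integral
  \<open>Phi s - A\<close> converges to the finite value \<open>mean - A\<close>. Monotone
  convergence then yields integrability and value together.\<close>

lemma inverse_integral: "integrable \<rho> (\<lambda>t. 1 / t)" "(\<integral>t. 1 / t \<partial>\<rho>) = mean - A"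
proof -
  let ?f = "\<lambda>i t. real (Suc i) / (t * (t + real (Suc i)))"
  have 1: "integrable \<rho> (?f i)" for i by (rule integrable_Phi_kernel) simp
  have eq: "?f i t = 1 / t - 1 / (t + real (Suc i))" if "t > 0" for i t
    using that by (simp add: divide_simps)
  have 2: "AE t in \<rho>. mono (\<lambda>i. ?f i t)"
  proof (rule AE_I2)
    fix t assume "t \<in> space \<rho>"
    then have t: "t > 0" by (simp add: space_rho)
    show "mono (\<lambda>i. ?f i t)"
      unfolding eq[OF t] using t by (intro monoI diff_left_mono divide_left_mono mult_pos_pos) auto
  qed
  have 3: "AE t in \<rho>. (\<lambda>i. ?f i t) \<longlonglongrightarrow> 1 / t"
  proof (rule AE_I2)
    fix t assume "t \<in> space \<rho>"
    then have t: "t > 0" by (simp add: space_rho)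
    show "(\<lambda>i. ?f i t) \<longlonglongrightarrow> 1 / t"
      unfolding eq[OF t] by real_asymp
  qed
  have at_top: "filterlim (\<lambda>i. real (Suc i)) at_top sequentially"
    by (rule filterlim_compose[OF filterlim_real_sequentially filterlim_Suc])
  have "(\<lambda>i. Phi (real (Suc i)) - A) \<longlonglongrightarrow> mean - A"
    by (intro tendsto_intros filterlim_compose[OF Phi_tendsto_mean at_top])
  then have 4: "(\<lambda>i. \<integral>t. ?f i t \<partial>\<rho>) \<longlonglongrightarrow> mean - A"
    by (simp add: Phi_eq del: of_nat_Suc)
  have 5: "(\<lambda>t. 1 / t) \<in> borel_measurable \<rho>" by (rule measurable_rho) simp
  show "integrable \<rho> (\<lambda>t. 1 / t)" "(\<integral>t. 1 / t \<partial>\<rho>) = mean - A"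
    using integrable_monotone_convergence[OF 1 2 3 4 5] integral_monotone_convergence[OF 1 2 3 4 5]
    by auto
qed

text \<open>A null measure would make \<open>Phi\<close> constant and equal to its limit
  \<open>mean\<close>, against the strict Jensen inequality for a nonconstant game.\<close>

lemma rho_nonnull: "emeasure \<rho> (space \<rho>) \<noteq> 0"
proof
  assume "emeasure \<rho> (space \<rho>) = 0"
  then have null: "AE t in \<rho>. False" by (simp add: AE_iff_measurable[of "space \<rho>"])
  have zero: "(\<integral>t. f t \<partial>\<rho>) = 0" for f :: "real \<Rightarrow> real"
    by (rule integral_eq_zero_AE) (use null in eventually_elim, simp)
  show False
    using inverse_integral(2) Phi_eq[of 1] Phi_less_mean[of 1] unfolding zero by simp
qed

sublocale stieltjes_measure \<rho>
  by unfold_locales (fact inverse_integral(1) rho_nonnull)+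

lemma Phi_eq_S:
  assumes "s > 0"
  shows "Phi s = mean - S 1 s"
proof -
  have "S 1 s = (\<integral>t. 1 / t - s / (t * (t + s)) \<partial>\<rho>)"
    unfolding S_def
    by (intro Bochner_Integration.integral_cong refl)
      (use assms in \<open>auto simp: space_rho divide_simps\<close>)
  also have "\<dots> = mean - A - (Phi s - A)"
    using inverse_integral integrable_Phi_kernel[OF assms] by (simp add: Phi_eq[OF assms])
  finally show ?thesis by simp
qed

sublocale stieltjes_game \<rho> mean
proof unfold_locales
  fix s :: real assume "s > 0"
  have "(\<integral>t. s / (t * (t + s)) \<partial>\<rho>) \<ge> 0"
    using \<open>s > 0\<close> by (intro integral_nonneg_AE AE_I2) (simp add: space_rho)
  then show "S 1 s \<le> mean"
    using Phi_eq[OF \<open>s > 0\<close>] Phi_eq_S[OF \<open>s > 0\<close>] A_nonneg by simp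
qed

end

section \<open>Concrete games as instances of the abstract setting\<close>

lemma prob_space_game_measure:
  assumes "is_interval I" "prob_distribution_on I F"
  shows "prob_space (game_measure I F)"
proof (rule prob_spaceI)
  have "I \<in> sets (interval_measure F)"
    using real_interval_borel_measurable[OF assms(1)] by simp
  then have "emeasure (game_measure I F) I = emeasure (interval_measure F) I"
    unfolding game_measure_def by (intro emeasure_restrict_space) auto
  moreover have "space (game_measure I F) = I"
    by (simp add: game_measure_def space_restrict_space)
  ultimately show "emeasure (game_measure I F) (space (game_measure I F)) = 1"
    using assms(2) by (simp add: prob_distribution_on_def)
qed

lemma measurable_game_measure:
  fixes a :: "real \<Rightarrow> real"
  assumes "a \<in> borel_measurable (restrict_space borel I)"
  shows "a \<in> borel_measurable (game_measure I F)"
proof -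
  have eq: "sets (game_measure I F) = sets (restrict_space borel I)"
    unfolding game_measure_def by (rule sets_restrict_space_cong) simp
  show ?thesis
    unfolding measurable_cong_sets[OF eq refl] by (rule assms)
qed

text \<open>\<open>real_of_ereal\<close> would send infinite values to 0. The value minus infinity
  is excluded by assumption, and plus infinity because a real function on a space of mass 1 cannot
  be infinite almost everywhere.\<close>

lemma AE_ge_ess_inf:
  fixes f :: "'a \<Rightarrow> real"
  assumes "prob_space M" "ess_inf M f > - \<infinity>"
  shows "AE x in M. real_of_ereal (ess_inf M f) \<le> f x"
proof -
  interpret prob_space M by fact
  define z where "z = esssup M (\<lambda>x. - ereal (f x))"
  have AE: "AE x in M. - ereal (f x) \<le> z"
    unfolding z_def by (rule esssup_AE)
  have "z \<noteq> \<infinity>" using assms(2) unfolding ess_inf_def z_def[symmetric] by auto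
  moreover have "z \<noteq> - \<infinity>"
  proof
    assume "z = - \<infinity>"
    with AE have "AE x in M. False" by simp
    then show False by simp
  qed
  ultimately obtain k where "z = ereal k" by (cases z) auto
  with AE show ?thesis
    unfolding ess_inf_def z_def[symmetric] by (simp add: minus_le_iff)
qed

text \<open>The lower bound \<xi> makes the negative part integrable. Only then does a finite
  difference of extended reals force the positive part to be finite.\<close>

lemma expected_value_eq:
  fixes a :: "real \<Rightarrow> real"
  assumes "prob_space (game_measure I F)" "a \<in> borel_measurable (game_measure I F)"
    and "AE x in game_measure I F. \<xi> \<le> a x" "expected_value I a F < \<infinity>"
  shows "integrable (game_measure I F) a"
    and "expected_value I a F = ereal (\<integral>x. a x \<partial>game_measure I F)"
proof -
  let ?M = "game_measure I F"
  interpret prob_space ?M by fact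
  define p where "p = (\<integral>\<^sup>+x. ennreal (a x) \<partial>?M)"
  define q where "q = (\<integral>\<^sup>+x. ennreal (- a x) \<partial>?M)"
  have E: "expected_value I a F = enn2ereal p - enn2ereal q"
    by (simp add: expected_value_def p_def q_def)
  have "q \<le> (\<integral>\<^sup>+x. ennreal \<bar>\<xi>\<bar> \<partial>?M)"
    unfolding q_def
  proof (rule nn_integral_mono_AE)
    show "AE x in ?M. ennreal (- a x) \<le> ennreal \<bar>\<xi>\<bar>"
      using assms(3) by eventually_elim (auto intro: ennreal_leI)
  qed
  also have "\<dots> = ennreal \<bar>\<xi>\<bar>" by (simp add: emeasure_space_1)
  finally have "q \<noteq> \<infinity>" by (auto simp: top_unique)
  then obtain q' where q': "q = ennreal q'" "q' \<ge> 0" by (cases q) auto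
  have "p \<noteq> \<infinity>"
    using assms(4) q' by (auto simp: E enn2ereal_ennreal)
  then obtain p' where p': "p = ennreal p'" "p' \<ge> 0" by (cases p) auto
  show int: "integrable ?M a"
    using assms(2) \<open>p \<noteq> \<infinity>\<close> \<open>q \<noteq> \<infinity>\<close> by (simp add: real_integrable_def p_def q_def)
  show "expected_value I a F = ereal (\<integral>x. a x \<partial>?M)"
    unfolding E real_lebesgue_integral_def[OF int] p_def[symmetric] q_def[symmetric]
    using p' q' by (simp add: enn2ereal_ennreal)
qed

locale investment_game = represented_game "game_measure I F" "\<lambda>x. a x - game_xi I a F" \<rho> A
  for I a F \<rho> A +
  assumes expected_value: "expected_value I a F = ereal (game_xi I a F + mean)"
begin

abbreviation \<xi> :: real where "\<xi> \<equiv> game_xi I a F"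

lemma opt_proportion_eq:
  assumes "s > 0" "u > 0" "m > 0" "mean - S 1 s = m + u"
  shows "opt_proportion I a F (\<xi> + m) u = u / (s + m + u)"
proof -
  have inj: "s' = s" if "s' > 0" "Phi s' = m + u" for s'
    using S_strict_antimono[of 1 s s'] S_strict_antimono[of 1 s' s] assms that
    by (cases s s' rule: linorder_cases) (auto simp: Phi_eq_S)
  have "(THE t. 0 < t \<and> t < u / (u + m) \<and>
      (\<integral>x. (a x - \<xi> - m - u) / ((a x - \<xi> - m) * t - t * u + u) \<partial>game_measure I F) = 0)
      = u / (s + m + u)"
    by (rule optimal_proportion_eq[OF assms(1-3) _ inj]) (use assms in \<open>simp_all add: Phi_eq_S\<close>)
  then show ?thesis
    unfolding opt_proportion_def by (simp add: diff_diff_eq add.commute add.left_commute)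
qed

lemma u_max_eq:
  assumes "s > 0" "mean - S 1 1 < mpar s"
  shows "u_max I a F (\<xi> + mpar s) = mean - S 1 s - mpar s"
proof -
  let ?T = "opt_proportion I a F (\<xi> + mpar s)"
  have "mpar s > 0" using assms S_le[of 1] by simp
  then have "(THE v. 0 < v \<and> v < mean - mpar s \<and> strict_mono_on {0<..<v} ?T \<and>
      strict_antimono_on {u. v < u \<and> u < mean - mpar s} ?T) = mean - S 1 s - mpar s"
    using assms by (intro maximizer_eq opt_proportion_eq) auto
  then show ?thesis
    unfolding u_max_def expected_value by simp
qed

text \<open>Along the curve the price is \<open>mean - S 1 s - mpar s\<close>. Its derivative in
  \<open>s\<close> is \<open>S 2 s\<close> minus that of \<open>mpar\<close>, and dividing by the
  latter leaves the summand -1.\<close>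

lemma u_max_deriv:
  assumes "N > 0" and N: "\<And>s. s > N \<Longrightarrow> mean - S 1 1 < mpar s" and "s > N"
  shows "(u_max I a F has_real_derivative S 2 s * (1 + S 2 s) / (2 * S 3 s * (s + mpar s)) - 1)
    (at (\<xi> + mpar s))"
proof -
  let ?d = "\<lambda>s. 2 * S 3 s * (s + mpar s) / (1 + S 2 s)"
  have s: "s > 0" using assms by simp
  have "(u_max I a F has_real_derivative (S 2 s - ?d s) / ?d s) (at (\<xi> + mpar s))"
  proof (rule DERIV_along_parametrization[OF \<open>s > N\<close>])
    show "((\<lambda>s. \<xi> + mpar s) has_real_derivative ?d y) (at y)" if "y > N" for y
      using mpar_deriv[of y] that \<open>N > 0\<close> by (auto intro!: derivative_eq_intros)
    show "?d y > 0" if "y > N" for y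
      using mpar_deriv_pos[of y] that \<open>N > 0\<close> by simp
    show "((\<lambda>s. mean - S 1 s - mpar s) has_real_derivative S 2 s - ?d s) (at s)"
      using mpar_deriv[OF s] S1_deriv[OF s] by (auto intro!: derivative_eq_intros)
    show "u_max I a F (\<xi> + mpar y) = mean - S 1 y - mpar y" if "y > N" for y
      using that \<open>N > 0\<close> by (intro u_max_eq assms) auto
  qed
  moreover have "(x - d) / d = x / d - 1" if "d > 0" for x d :: real
    using that by (simp add: diff_divide_distrib)
  then have "(S 2 s - ?d s) / ?d s = S 2 s / ?d s - 1"
    using mpar_deriv_pos[OF s] by blast
  ultimately show ?thesis by simp
qed

end

lemma investment_gameI:
  assumes "game I a F" "associated_measure I a F \<rho>" "expected_value I a F < \<infinity>"
  shows "investment_game I a F \<rho> (enn2real (1 / game_H I a F))"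
proof -
  let ?M = "game_measure I F"
  define \<xi> where "\<xi> = game_xi I a F"
  have "is_interval I" "prob_distribution_on I F" "a \<in> borel_measurable (restrict_space borel I)"
    and nonconst: "\<not> (\<exists>k. AE x in ?M. a x = k)" and inf: "ess_inf ?M a > - \<infinity>"
    using assms(1) by (auto simp: game_def)
  then have prob: "prob_space ?M" and meas: "a \<in> borel_measurable ?M"
    by (auto intro: prob_space_game_measure measurable_game_measure)
  interpret prob_space ?M by (fact prob)
  have ge: "AE x in ?M. \<xi> \<le> a x"
    unfolding \<xi>_def game_xi_def by (rule AE_ge_ess_inf[OF prob inf])
  note E = expected_value_eq[OF prob meas ge assms(3)]
  interpret centred_game ?M "\<lambda>x. a x - \<xi>"
  proof unfold_locales
    show "integrable ?M (\<lambda>x. a x - \<xi>)" using E(1) by simp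
    show "AE x in ?M. 0 \<le> a x - \<xi>" using ge by eventually_elim simp
    show "\<not> (\<exists>k. AE x in ?M. a x - \<xi> = k)"
    proof
      assume "\<exists>k. AE x in ?M. a x - \<xi> = k"
      then obtain k where "AE x in ?M. a x - \<xi> = k" by blast
      then have "AE x in ?M. a x = k + \<xi>" by eventually_elim linarith
      with nonconst show False by blast
    qed
  qed
  interpret represented_game ?M "\<lambda>x. a x - \<xi>" \<rho> "enn2real (1 / game_H I a F)"
  proof unfold_locales
    show "sets \<rho> = sets (restrict_space borel {0<..})"
      "(\<integral>\<^sup>+t. ennreal (1 / (t * (t + 1))) \<partial>\<rho>) < \<infinity>"
      using assms(2) by (auto simp: associated_measure_def)
    fix s :: real assume "s > 0"
    then have "s - \<xi> > - \<xi>" by simp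
    then have "game_Psi I a F (s - \<xi>) = \<xi> + enn2real (1 / game_H I a F)
        + (\<integral>t. (s - \<xi> + \<xi>) / (t * (t + (s - \<xi>) + \<xi>)) \<partial>\<rho>)"
      using assms(2) unfolding associated_measure_def \<xi>_def[symmetric] by blast
    moreover have shift: "a x - \<xi> + s = a x + (s - \<xi>)" for x by simp
    have "Phi s = game_Psi I a F (s - \<xi>) - \<xi>"
      unfolding Phi_def h_def game_Psi_def shift by simp
    ultimately show "Phi s = enn2real (1 / game_H I a F) + (\<integral>t. s / (t * (t + s)) \<partial>\<rho>)"
      by simp
  qed simp
  have "expected_value I a F = ereal (\<xi> + mean)"
    using E by (simp add: mean_def prob_space)
  with represented_game_axioms show ?thesis
    unfolding \<xi>_def by (intro investment_game.intro investment_game_axioms.intro)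
qed

section \<open>The limits as \<open>m\<close> tends to \<open>E\<close>\<close>

theorem theorem5p2:
  fixes I :: "real set" and a F :: "real \<Rightarrow> real" and \<rho> :: "real measure" and L :: real
  assumes "game I a F"
    and "associated_measure I a F \<rho>"
    and "expected_value I a F < \<infinity>"
    and "((\<lambda>m. u_max I a F m / (real_of_ereal (expected_value I a F) - m)) \<longlongrightarrow> L)
           (at_left (real_of_ereal (expected_value I a F)))"
    and "L \<noteq> 0"
  shows "(\<forall>\<^sub>F m in at_left (real_of_ereal (expected_value I a F)).
            u_max I a F differentiable at m) \<and>
         (\<exists>D r. (deriv (u_max I a F) \<longlongrightarrow> D)
                  (at_left (real_of_ereal (expected_value I a F))) \<and>
            0 \<le> r \<and> r < 1 \<and>
            L = - D \<and> - D = (1 - r) / (2 - r) \<and>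
            regularly_varying r (\<lambda>x. measure \<rho> {0<..x}) \<and>
            (\<forall>n::real. n > 1 \<longrightarrow>
               has_upper_order (\<lambda>x. \<integral>t. (x / (x + t)) powr n \<partial>\<rho>) (ereal r)))"
proof -
  interpret investment_game I a F \<rho> "enn2real (1 / game_H I a F)"
    by (rule investment_gameI[OF assms(1-3)])
  let ?u = "u_max I a F"
  let ?G = "\<lambda>s. \<xi> + mpar s"
  have at_left: "at_left (\<xi> + mean) = filtermap ?G at_top"
  proof (rule filtermap_at_top_eq_at_left[symmetric])
    show "?G x < ?G y" if "0 < x" "x < y" for x y
      using mpar_strict_mono[OF that] by simp
    show "continuous_on {0<..} ?G"
      by (intro continuous_on_add continuous_on_const continuous_on_mpar)
    show "(?G \<longlongrightarrow> \<xi> + mean) at_top"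
      by (intro tendsto_add tendsto_const mpar_tendsto)
  qed
  have "\<forall>\<^sub>F s in at_top. mean - S 1 1 < mpar s"
    by (rule order_tendstoD(1)[OF mpar_tendsto]) (simp add: S_pos)
  then obtain N0 where N0: "\<And>s. s > N0 \<Longrightarrow> mean - S 1 1 < mpar s"
    unfolding eventually_at_top_dense by blast
  define N where "N = max N0 1"
  have N: "N > 0" "\<And>s. s > N \<Longrightarrow> mean - S 1 1 < mpar s"
    using N0 by (auto simp: N_def)
  have u_eq: "?u (?G s) = S 2 s * (s + mpar s)" if "s > N" for s
    using u_max_eq[of s] that N mpar_stationary[of s] by simp
  have du: "(?u has_real_derivative S 2 s * (1 + S 2 s) / (2 * S 3 s * (s + mpar s)) - 1) (at (?G s))"
    if "s > N" for s
    using u_max_deriv[OF N that] .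
  have add_ratio: "((\<lambda>s. (s + mpar s) / s) \<longlongrightarrow> 1) at_top"
  proof -
    have "((\<lambda>s. 1 + mpar s / s) \<longlongrightarrow> 1 + 0) at_top"
      by (intro tendsto_intros real_tendsto_divide_at_top[OF mpar_tendsto] filterlim_ident)
    then have "((\<lambda>s. 1 + mpar s / s) \<longlongrightarrow> 1) at_top" by simp
    then show ?thesis
      by (rule Lim_transform_eventually)
        (use eventually_gt_at_top[of 0] in \<open>eventually_elim, simp add: add_divide_distrib\<close>)
  qed

  define Q where "Q s = S 2 s * (s + mpar s) / (S 2 s * (s + mpar s) + S 1 s)" for s
  have Q: "(Q \<longlongrightarrow> L) at_top"
  proof -
    have "((\<lambda>s. ?u (?G s) / (\<xi> + mean - ?G s)) \<longlongrightarrow> L) at_top"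
      using assms(4) unfolding expected_value real_of_ereal.simps at_left by (simp add: filterlim_filtermap)
    then show ?thesis
    proof (rule Lim_transform_eventually)
      show "\<forall>\<^sub>F s in at_top. ?u (?G s) / (\<xi> + mean - ?G s) = Q s"
        using eventually_gt_at_top[of N]
      proof eventually_elim
        case (elim s)
        then show ?case
          using u_eq[OF elim] mpar_stationary[of s] N by (simp add: Q_def)
      qed
    qed
  qed
  define w where "w s = s * S 2 s / S 1 s" for s
  have w_bounds: "0 \<le> w s \<and> w s \<le> 1" if "s > 0" for s
    using S_Suc_le[of 1 s] S_pos[of 1 s] S_pos[of 2 s] that by (simp add: w_def numeral_2_eq_2)
  have Q_eq: "Q s = w s * ((s + mpar s) / s) / (w s * ((s + mpar s) / s) + 1)" if "s > 0" for s
  proof -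
    have S1: "S 1 s > 0" using that by (simp add: S_pos)
    define k where "k = S 2 s * (s + mpar s)"
    have "k > 0" using that S_pos[of 2 s] add_mpar_pos[of s] by (simp add: k_def)
    have eq: "w s * ((s + mpar s) / s) = k / S 1 s"
      using that by (simp add: w_def k_def)
    show ?thesis
      unfolding eq Q_def k_def[symmetric] using S1 \<open>k > 0\<close> by (simp add: field_simps)
  qed
  have ratio_pos: "w s * ((s + mpar s) / s) \<ge> 0" if "s > 0" for s
    using w_bounds[OF that] add_mpar_pos[OF that] that by simp
  \<comment> \<open>Inverting \<open>k / (k + 1)\<close> in the limit requires \<open>L\<close> to
    stay away from 1. Since \<open>w\<close> is at most 1 and the other factor is eventually below
    2, \<open>k\<close> is at most 2, which gives 2/3.\<close>
  have "L \<le> 2 / 3"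
  proof (rule tendsto_upperbound[OF Q _ trivial_limit_at_top_linorder])
    show "\<forall>\<^sub>F s in at_top. Q s \<le> 2 / 3"
      using order_tendstoD(2)[OF add_ratio, of 2, simplified] eventually_gt_at_top[of 0]
    proof eventually_elim
      case (elim s)
      have "w s * ((s + mpar s) / s) \<le> 1 * 2"
        using elim w_bounds[of s] add_mpar_pos[of s] by (intro mult_mono) auto
      moreover have "k / (k + 1) \<le> 2 / 3" if "0 \<le> k" "k \<le> 1 * 2" for k :: real
        using that by (simp add: field_simps)
      ultimately show ?case
        unfolding Q_eq[OF elim(2)] using ratio_pos[OF elim(2)] by blast
    qed
  qed
  \<comment> \<open>This solves \<open>L = \<beta> / (\<beta> + 1)\<close>; as
    \<open>(s + mpar s) / s\<close> tends to 1, it is also the limit of \<open>w\<close>.\<close>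
  define \<beta> where "\<beta> = L / (1 - L)"
  have w: "(w \<longlongrightarrow> \<beta>) at_top"
  proof -
    have "((\<lambda>s. Q s / (1 - Q s) / ((s + mpar s) / s)) \<longlongrightarrow> L / (1 - L) / 1) at_top"
      using \<open>L \<le> 2 / 3\<close> by (intro tendsto_intros Q add_ratio) auto
    then have "((\<lambda>s. Q s / (1 - Q s) / ((s + mpar s) / s)) \<longlongrightarrow> \<beta>) at_top"
      by (simp add: \<beta>_def)
    then show ?thesis
    proof (rule Lim_transform_eventually)
      show "\<forall>\<^sub>F s in at_top. Q s / (1 - Q s) / ((s + mpar s) / s) = w s"
        using eventually_gt_at_top[of 0]
      proof eventually_elim
        case (elim s)
        define k where "k = (s + mpar s) / s"
        have "k > 0" using add_mpar_pos[OF elim] elim by (simp add: k_def)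
        have "w s * k \<ge> 0" using ratio_pos[OF elim] by (simp add: k_def)
        have "Q s = w s * k / (w s * k + 1)" using Q_eq[OF elim] by (simp add: k_def)
        moreover from this have "1 - Q s = 1 / (w s * k + 1)"
          using \<open>w s * k \<ge> 0\<close> by (simp add: field_simps)
        ultimately have "Q s / (1 - Q s) = w s * k"
          using \<open>w s * k \<ge> 0\<close> by simp
        then show ?case using \<open>k > 0\<close> by (simp add: k_def[symmetric])
      qed
    qed
  qed
  have "0 \<le> \<beta>" "\<beta> \<le> 1"
  proof -
    show "0 \<le> \<beta>"
      by (rule tendsto_lowerbound[OF w _ trivial_limit_at_top_linorder])
        (use eventually_gt_at_top[of 0] in \<open>eventually_elim, simp add: w_bounds\<close>)
    show "\<beta> \<le> 1"
      by (rule tendsto_upperbound[OF w _ trivial_limit_at_top_linorder])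
        (use eventually_gt_at_top[of 0] in \<open>eventually_elim, simp add: w_bounds\<close>)
  qed
  moreover have "\<beta> \<noteq> 0" using \<open>L \<noteq> 0\<close> \<open>L \<le> 2 / 3\<close> by (simp add: \<beta>_def)
  ultimately have \<beta>: "0 < \<beta>" "\<beta> \<le> 1" by auto
  have L_eq: "L = \<beta> / (1 + \<beta>)"
    using \<open>L \<le> 2 / 3\<close> by (simp add: \<beta>_def field_simps)
  define r where "r = 1 - \<beta>"
  interpret regular_stieltjes_measure \<rho> r
    using \<beta> w by unfold_locales (auto simp: r_def w_def[abs_def])

  \<comment> \<open>This is the derivative from \<open>u_max_deriv\<close> with numerator and
    denominator divided by \<open>S 2 s\<close>, grouped into factors with known limits;
    \<open>2 - r\<close> comes from \<open>S_regular\<close> at \<open>n = 2\<close>.\<close>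
  have "((\<lambda>s. (1 + S 2 s) / ((s * (2 * S 3 s) / S 2 s) * ((s + mpar s) / s)) - 1)
      \<longlongrightarrow> (1 + 0) / ((2 - r) * 1) - 1) at_top"
  proof -
    have "((\<lambda>s. s * (2 * S 3 s) / S 2 s) \<longlongrightarrow> 2 - r) at_top"
      using S_regular[of 2] by (simp add: numeral_3_eq_3 numeral_2_eq_2)
    then show ?thesis
      using r_less_1 by (intro tendsto_intros S_2_tendsto_0 add_ratio) auto
  qed
  also have "(1 + 0) / ((2 - r) * 1) - 1 = - ((1 - r) / (2 - r))"
    using r_less_1 by (simp add: field_simps)
  finally have "((\<lambda>s. deriv ?u (?G s)) \<longlongrightarrow> - ((1 - r) / (2 - r))) at_top"
  proof (rule Lim_transform_eventually)
    show "\<forall>\<^sub>F s in at_top. (1 + S 2 s) / ((s * (2 * S 3 s) / S 2 s) * ((s + mpar s) / s)) - 1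
        = deriv ?u (?G s)"
      using eventually_gt_at_top[of N]
    proof eventually_elim
      case (elim s)
      have "s > 0" using elim N by simp
      then show ?case
        unfolding DERIV_imp_deriv[OF du[OF elim]]
        using S_pos[of 2 s] by (simp add: mult.commute)
    qed
  qed
  then have "(deriv ?u \<longlongrightarrow> - ((1 - r) / (2 - r))) (at_left (\<xi> + mean))"
    unfolding at_left by (simp add: filterlim_filtermap)
  moreover have "\<forall>\<^sub>F m in at_left (\<xi> + mean). ?u differentiable at m"
    unfolding at_left eventually_filtermap
    using eventually_gt_at_top[of N]
    by eventually_elim (use du real_differentiable_def in blast)
  moreover have "L = (1 - r) / (2 - r)"
    using L_eq by (simp add: r_def)
  moreover have "regularly_varying r (\<lambda>x. measure \<rho> {0<..x})"
    using U_regular by (simp add: U_def[abs_def])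
  moreover have "0 \<le> r" using \<beta> by (simp add: r_def)
  ultimately show ?thesis
    unfolding expected_value real_of_ereal.simps
    by (intro conjI exI[of _ "- ((1 - r) / (2 - r))"] exI[of _ r])
      (auto simp: r_less_1 upper_order)
qed

end
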